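(* Let $Y$ be a Banach sequence lattice and $X$ a Banach lattice. Then $\ell^{\tau,Y}(X)$ is a Banach lattice (with the componentwise order), and consequently $\ell_0^{\tau,Y}(X)$ is a Banach lattice.
   Context: All vector spaces are real. A Banach sequence lattice is a linear subspace $Y\subset\mathbb{R}^{\mathbb{N}}$ containing all canonical sequences $e_n$, with a complete norm $\|\cdot\|_Y$ such that if $f\in\mathbb{R}^{\mathbb{N}}$, $g\in Y$ and $|f|\le|g|$ pointwise, then $f\in Y$ and $\|f\|_Y\le\|g\|_Y$. A finite tuple $(t_1,\dots,t_n)\in\mathbb{R}^n$ is identified with $(t_1,\dots,t_n,0,0,\dots)\in Y$. Krivine's functional calculus: let $\mathcal{H}_n$ be the space of continuous $h:\mathbb{R}^n\to\mathbb{R}$ with $h(\lambda t)=\lambda h(t)$ for $\lambda\ge0$, with the pointwise order. For a Banach lattice $X$ and $x=(x_1,\dots,x_n)\in X^n$ there is a unique linear map $\tau_{n,x}:\mathcal{H}_n\to X$ with $\tau_{n,x}(\pi_{n,j})=x_j$ for each coordinate projection $\pi_{n,j}$ and $\tau_{n,x}(h_1\vee h_2)=\tau_{n,x}(h_1)\vee\tau_{n,x}(h_2)$. Write $\|(x_1,\dots,x_n)\|_Y:=\tau_{n,x}\big(t\mapsto\|(t_1,\dots,t_n)\|_Y\big)\in X$ and $\|(x_1,\dots,x_n)\|_{X^n,Y,\tau}:=\big\|\,\|(x_1,\dots,x_n)\|_Y\big\|_X\in\mathbb{R}$. $\ell^{\tau,Y}(X):=\{\{x_j\}_{j=1}^\infty\in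 X^{\mathbb{N}}:\sup_{n}\|(x_1,\dots,x_n)\|_{X^n,Y,\tau}<\infty\}$ with norm $\|\{x_j\}\|_{\ell^{\tau,Y}(X)}:=\sup_n\|(x_1,\dots,x_n)\|_{X^n,Y,\tau}$. $\ell_{00}^{\tau,Y}(X)$ is the subspace of eventually zero sequences and $\ell_0^{\tau,Y}(X)$ is its closure in $\ell^{\tau,Y}(X)$. *)

theory Defs
  imports
    "HOL-Analysis.Analysis"
    "HOL-Library.Function_Algebras"
    "HOL-Library.Lattice_Algebras"
begin

instantiation "fun" :: (type, real_vector) real_vector
begin

definition scaleR_fun_def: "r *\<^sub>R f = (\<lambda>x. r *\<^sub>R f x)"

instance
  by standard (simp_all add: scaleR_fun_def fun_eq_iff scaleR_add_left scaleR_add_right)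

end

lemma scaleR_fun_apply [simp]: "(r *\<^sub>R f) x = r *\<^sub>R f x"
  by (simp add: scaleR_fun_def)

instance "fun" :: (type, ordered_real_vector) ordered_real_vector
  by standard (auto simp: le_fun_def intro: scaleR_left_mono scaleR_right_mono)


section \<open>Banach lattices\<close>

text \<open>The modulus in \<^class>\<open>lattice_ab_group_add_abs\<close> is \<^prop>\<open>\<bar>x\<bar> = sup x (- x)\<close>.\<close>

class banach_lattice = banach + ordered_real_vector + lattice_ab_group_add_abs +
  assumes norm_mono_abs: "\<bar>x\<bar> \<le> \<bar>y\<bar> \<Longrightarrow> norm x \<le> norm y"

text \<open>
  The spaces constructed below depend on a term (the lattice norm of \<open>Y\<close>) and hence are not types;
  the following locales express the same notions for a linear subspace \<open>V\<close> of a type with a norm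
  \<open>N\<close> of its own. Only the values of \<open>N\<close> on \<open>V\<close> are relevant.
\<close>

locale banach_space_on =
  fixes V :: "'v::real_vector set" and N :: "'v \<Rightarrow> real"
  assumes subspace: "subspace V"
    and norm_nonneg: "x \<in> V \<Longrightarrow> 0 \<le> N x"
    and norm_eq_zero: "x \<in> V \<Longrightarrow> N x = 0 \<longleftrightarrow> x = 0"
    and norm_scaleR: "x \<in> V \<Longrightarrow> N (r *\<^sub>R x) = \<bar>r\<bar> * N x"
    and norm_triangle: "x \<in> V \<Longrightarrow> y \<in> V \<Longrightarrow> N (x + y) \<le> N x + N y"
    and complete:
      "range f \<subseteq> V \<Longrightarrow> (\<forall>e>0. \<exists>M. \<forall>m\<ge>M. \<forall>n\<ge>M. N (f m - f n) < e) \<Longrightarrow>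
       \<exists>l\<in>V. (\<lambda>n. N (f n - l)) \<longlonglongrightarrow> 0"

text \<open>
  Suprema and infima are taken within \<open>V\<close>; they need not be those of the ambient type, even if the
  latter exist.
\<close>

definition is_sup_in :: "'v::order set \<Rightarrow> 'v \<Rightarrow> 'v \<Rightarrow> 'v \<Rightarrow> bool" where
  "is_sup_in V x y s \<longleftrightarrow>
     s \<in> V \<and> x \<le> s \<and> y \<le> s \<and> (\<forall>u\<in>V. x \<le> u \<longrightarrow> y \<le> u \<longrightarrow> s \<le> u)"

definition is_inf_in :: "'v::order set \<Rightarrow> 'v \<Rightarrow> 'v \<Rightarrow> 'v \<Rightarrow> bool" where
  "is_inf_in V x y s \<longleftrightarrow>
     s \<in> V \<and> s \<le> x \<and> s \<le> y \<and> (\<forall>u\<in>V. u \<le> x \<longrightarrow> u \<le> y \<longrightarrow> u \<le> s)"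

text \<open>
  \<open>V\<close> carries the order of the ambient ordered vector space, so compatibility of the order with the
  linear structure is inherited. In \<open>norm_mono\<close>, \<open>a\<close> and \<open>b\<close> are the moduli of \<open>x\<close> and \<open>y\<close> in \<open>V\<close>.
\<close>

locale banach_lattice_on = banach_space_on V N
  for V :: "'v::ordered_real_vector set" and N :: "'v \<Rightarrow> real" +
  assumes ex_sup: "x \<in> V \<Longrightarrow> y \<in> V \<Longrightarrow> \<exists>s. is_sup_in V x y s"
    and ex_inf: "x \<in> V \<Longrightarrow> y \<in> V \<Longrightarrow> \<exists>s. is_inf_in V x y s"
    and norm_mono:
      "x \<in> V \<Longrightarrow> y \<in> V \<Longrightarrow> is_sup_in V x (- x) a \<Longrightarrow> is_sup_in V y (- y) b \<Longrightarrow> a \<le> b \<Longrightarrow>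
       N x \<le> N y"

lemma banach_lattice_on_UNIV: "banach_lattice_on (UNIV :: 'a::banach_lattice set) norm"
proof
  fix f :: "nat \<Rightarrow> 'a"
  assume "\<forall>e>0. \<exists>M. \<forall>m\<ge>M. \<forall>n\<ge>M. norm (f m - f n) < e"
  then have "Cauchy f"
    by (simp add: Cauchy_def dist_norm)
  then obtain l where "f \<longlonglongrightarrow> l"
    by (auto simp: Cauchy_convergent_iff convergent_def)
  then show "\<exists>l\<in>UNIV. (\<lambda>n. norm (f n - l)) \<longlonglongrightarrow> 0"
    by (auto simp: tendsto_norm_zero_iff intro: LIM_zero)
next
  fix x y :: 'a
  show "\<exists>s. is_sup_in UNIV x y s"
    by (rule exI[of _ "sup x y"]) (simp add: is_sup_in_def)
  show "\<exists>s. is_inf_in UNIV x y s"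
    by (rule exI[of _ "inf x y"]) (simp add: is_inf_in_def)
next
  fix x y a b :: 'a
  assume *: "is_sup_in UNIV x (- x) a" "is_sup_in UNIV y (- y) b" "a \<le> b"
  have "\<bar>x\<bar> = a" "\<bar>y\<bar> = b"
    using *(1,2) by (auto simp: abs_lattice is_sup_in_def intro!: antisym)
  with *(3) show "norm x \<le> norm y"
    by (simp add: norm_mono_abs)
qed (simp_all add: norm_triangle_ineq)

locale banach_sequence_lattice = banach_space_on Y normY
  for Y :: "(nat \<Rightarrow> real) set" and normY :: "(nat \<Rightarrow> real) \<Rightarrow> real" +
  assumes unit_mem: "(\<lambda>k. if k = n then 1 else 0) \<in> Y"
    and ideal_mem: "g \<in> Y \<Longrightarrow> (\<And>k. \<bar>f k\<bar> \<le> \<bar>g k\<bar>) \<Longrightarrow> f \<in> Y"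
    and ideal_norm: "g \<in> Y \<Longrightarrow> (\<And>k. \<bar>f k\<bar> \<le> \<bar>g k\<bar>) \<Longrightarrow> normY f \<le> normY g"


section \<open>Krivine's functional calculus\<close>

text \<open>
  Functions on \<open>\<real>\<^sup>n\<close> are encoded as functions of a real sequence that depend on its first \<open>n\<close> entries
  only. Composition with the projection to the first \<open>n\<close> entries identifies the continuous functions
  on \<open>\<real>\<^sup>n\<close> with the functions of this kind that are continuous for the product topology, which is the
  topology on \<^typ>\<open>nat \<Rightarrow> real\<close> below. The pointwise order and operations correspond.
\<close>

definition hom_funs :: "nat \<Rightarrow> ((nat \<Rightarrow> real) \<Rightarrow> real) set" where
  "hom_funs n = {h. continuous_on UNIV h \<and>
     (\<forall>c\<ge>0. \<forall>t. h (\<lambda>i. c * t i) = c * h t) \<and>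
     (\<forall>s t. (\<forall>i<n. s i = t i) \<longrightarrow> h s = h t)}"

text \<open>
  Only \<open>x 0, \<dots>, x (n - 1)\<close> matter. Extensionality fixes the values outside of \<^term>\<open>hom_funs n\<close>,
  so that uniqueness of the calculus becomes equality of functions.
\<close>

definition is_krivine_calculus ::
  "nat \<Rightarrow> (nat \<Rightarrow> 'a::banach_lattice) \<Rightarrow> (((nat \<Rightarrow> real) \<Rightarrow> real) \<Rightarrow> 'a) \<Rightarrow> bool" where
  "is_krivine_calculus n x \<tau> \<longleftrightarrow>
     \<tau> \<in> extensional (hom_funs n) \<and>
     (\<forall>h1\<in>hom_funs n. \<forall>h2\<in>hom_funs n. \<tau> (\<lambda>t. h1 t + h2 t) = \<tau> h1 + \<tau> h2) \<and>
     (\<forall>h\<in>hom_funs n. \<forall>r. \<tau> (\<lambda>t. r * h t) = r *\<^sub>R \<tau> h) \<and>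
     (\<forall>j<n. \<tau> (\<lambda>t. t j) = x j) \<and>
     (\<forall>h1\<in>hom_funs n. \<forall>h2\<in>hom_funs n. \<tau> (\<lambda>t. max (h1 t) (h2 t)) = sup (\<tau> h1) (\<tau> h2))"

definition krivine ::
  "nat \<Rightarrow> (nat \<Rightarrow> 'a::banach_lattice) \<Rightarrow> ((nat \<Rightarrow> real) \<Rightarrow> real) \<Rightarrow> 'a" where
  "krivine n x = (THE \<tau>. is_krivine_calculus n x \<tau>)"

definition krivine_norm ::
  "((nat \<Rightarrow> real) \<Rightarrow> real) \<Rightarrow> nat \<Rightarrow> (nat \<Rightarrow> 'a::banach_lattice) \<Rightarrow> 'a" where
  "krivine_norm normY n x = krivine n x (\<lambda>t. normY (\<lambda>i. if i < n then t i else 0))"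


section \<open>The spaces of sequences\<close>

definition ell_tau :: "((nat \<Rightarrow> real) \<Rightarrow> real) \<Rightarrow> (nat \<Rightarrow> 'a::banach_lattice) set" where
  "ell_tau normY = {x. bdd_above ((\<lambda>n. norm (krivine_norm normY n x)) ` {1..})}"

definition ell_tau_norm ::
  "((nat \<Rightarrow> real) \<Rightarrow> real) \<Rightarrow> (nat \<Rightarrow> 'a::banach_lattice) \<Rightarrow> real" where
  "ell_tau_norm normY x = (SUP n\<in>{1..}. norm (krivine_norm normY n x))"

definition ell_tau_00 :: "((nat \<Rightarrow> real) \<Rightarrow> real) \<Rightarrow> (nat \<Rightarrow> 'a::banach_lattice) set" where
  "ell_tau_00 normY = {x \<in> ell_tau normY. \<exists>m. \<forall>k\<ge>m. x k = 0}"

definition ell_tau_0 :: "((nat \<Rightarrow> real) \<Rightarrow> real) \<Rightarrow> (nat \<Rightarrow> 'a::banach_lattice) set" where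
  "ell_tau_0 normY =
     {x \<in> ell_tau normY. \<forall>e>0. \<exists>y\<in>ell_tau_00 normY. ell_tau_norm normY (x - y) < e}"

end

theory Submission
  imports Defs
begin

text \<open>
  Krivine's calculus is constructed without representing ideals by spaces of continuous functions.
  Every expression in the coordinates is a difference of maxima of finitely many linear functions.
  If one maximum of linear functions is dominated by another, then, by separation, its linear
  functions are convex combinations of those of the other, so that the same inequality holds between
  the corresponding suprema in \<open>X\<close>. Hence the calculus is positive, and well-defined, on piecewise
  linear functions; these are dense in the continuous homogeneous functions, relative to the
  \<open>l\<^sub>1\<close>-norm, and \<open>X\<close> is complete. Uniqueness makes the calculus compatible with composition, which
  transfers the norm inequalities of \<open>Y\<close> to tuples in \<open>X\<close>. Completeness of the sequence spaces then
  follows since, for fixed \<open>n\<close>, the norm of an \<open>n\<close>-tuple is continuous in its entries.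
\<close>


section \<open>Separation of a point from a finite set\<close>

text \<open>The obstacle is that an element of X is at first attached to an expression in the
  coordinates, and two expressions for the same function might yield different elements. So the
  calculus starts as a relation between functions and elements and becomes single-valued only
  through positivity. For a difference \<open>p - q\<close> positivity amounts to comparing two
  finite suprema, for which separation in finitely many real coordinates suffices. The l1-norm
  serves as gauge because it is itself an expression, with value
  \<open>\<Sum>i<n. \<bar>x i\<bar>\<close>: a pointwise bound by \<open>e * l1norm n t\<close>
  becomes a bound in the norm of X, so approximation on the unit sphere of l1 is strong enough for
  convergence of the values. An inequality that involves two tuples is not an inequality between
  functions of either one. Both are therefore concatenated into one tuple of length
  \<open>n + n\<close>, and the two sides are compared as functions of the same \<open>n + n\<close>
  variables.\<close>

definition lin :: "nat \<Rightarrow> (nat \<Rightarrow> real) \<Rightarrow> (nat \<Rightarrow> 'a::real_vector) \<Rightarrow> 'a" where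
  "lin n a x = (\<Sum>i<n. a i *\<^sub>R x i)"

lemma compact_PiE_fun:
  fixes S :: "'i \<Rightarrow> real set"
  assumes "\<And>i. compact (S i)"
  shows "compact (Pi\<^sub>E UNIV S)"
  using assms by (simp add: compactin_PiE flip: compactin_euclidean_iff euclidean_product_topology)

lemma compact_simplex:
  fixes A :: "'i set"
  shows "compact {c :: 'i \<Rightarrow> real. (\<forall>a\<in>A. 0 \<le> c a) \<and> (\<forall>a. a \<notin> A \<longrightarrow> c a = 0) \<and> sum c A = 1}"
    (is "compact ?D")
proof (cases "finite A")
  case True
  have "?D = Pi\<^sub>E UNIV (\<lambda>a. if a \<in> A then {0..1} else {0}) \<inter> {c. sum c A = 1}" (is "_ = ?P \<inter> ?C")
  proof (intro equalityI subsetI)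
    fix c assume c: "c \<in> ?D"
    have "c a \<le> 1" if "a \<in> A" for a
      using member_le_sum[OF that, of c] c True by auto
    with c show "c \<in> ?P \<inter> ?C"
      by (auto simp: PiE_def Pi_def)
  next
    fix c assume "c \<in> ?P \<inter> ?C"
    then have "c a \<in> (if a \<in> A then {0..1} else {0})" "sum c A = 1" for a
      by (auto simp: PiE_iff)
    then show "c \<in> ?D"
      by (force split: if_splits)
  qed
  moreover have "compact ?P"
    by (rule compact_PiE_fun) auto
  moreover have "closed ?C"
    by (intro closed_Collect_eq continuous_on_sum continuous_on_const continuous_on_product_coordinates)
  ultimately show ?thesis
    by (simp add: compact_Int_closed)
\<comment> \<open>A sum over an infinite set is 0 by convention, so the set is empty in this
  case.\<close>
qed simp

text \<open>Take the convex combination nearest to \<open>b\<close> in the first \<open>n\<close>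
  coordinates, with difference \<open>v\<close>. Testing the hypothesis at \<open>- v\<close> yields
  some \<open>a\<close> in \<open>A\<close> on the far side of \<open>b\<close>, and a small move
  towards \<open>a\<close> would shorten a nonzero \<open>v\<close>.\<close>

lemma convex_combination_of_pointwise_le:
  fixes A :: "(nat \<Rightarrow> real) set" and b :: "nat \<Rightarrow> real"
  assumes A: "finite A" "A \<noteq> {}"
    and le: "\<And>t :: nat \<Rightarrow> real. \<exists>a\<in>A. lin n b t \<le> lin n a t"
  shows "\<exists>c. (\<forall>a\<in>A. 0 \<le> c a) \<and> sum c A = 1 \<and> (\<forall>i<n. b i = (\<Sum>a\<in>A. c a * a i))"
proof -
  define D where "D = {c. (\<forall>a\<in>A. 0 \<le> c a) \<and> (\<forall>a. a \<notin> A \<longrightarrow> c a = 0) \<and> sum c A = (1::real)}"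
  define v where "v c i = (\<Sum>a\<in>A. c a * a i) - b i" for c and i :: nat
  define F where "F c = (\<Sum>i<n. (v c i)\<^sup>2)" for c
  have "compact D"
    unfolding D_def by (rule compact_simplex)
  moreover obtain a0 where "a0 \<in> A"
    using A by auto
  then have "(\<lambda>a. if a = a0 then 1 else 0) \<in> D"
    using A by (auto simp: D_def)
  then have "D \<noteq> {}"
    by auto
  moreover have "continuous_on UNIV F"
    unfolding F_def v_def
    by (intro continuous_intros continuous_on_product_coordinates)
  then have "continuous_on D F"
    by (rule continuous_on_subset) simp
  ultimately obtain c where c: "c \<in> D" and min: "\<And>c'. c' \<in> D \<Longrightarrow> F c \<le> F c'"
    using continuous_attains_inf[of D F] by auto
  have "F c = 0"
  proof (rule ccontr)
    assume "F c \<noteq> 0"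
    then have pos: "F c > 0"
      by (simp add: F_def sum_nonneg order_less_le)
    obtain a where a: "a \<in> A" and "lin n b (\<lambda>i. - v c i) \<le> lin n a (\<lambda>i. - v c i)"
      using le by blast
    then have va: "(\<Sum>i<n. v c i * (a i - b i)) \<le> 0"
      by (simp add: lin_def algebra_simps sum_subtractf sum_negf)
    define w where "w i = a i - b i - v c i" for i
    define d where "d = (\<Sum>i<n. (w i)\<^sup>2)"
    have d: "d \<ge> 0"
      by (simp add: d_def sum_nonneg)
    \<comment> \<open>The squared distance changes by at most
      \<open>- 2 * s * F c + s\<^sup>2 * d\<close>. This step length keeps the quadratic term below
      \<open>s * F c\<close>; the added 1 covers \<open>d = 0\<close>, and the bound 1 keeps the new
      weights nonnegative.\<close>
    define s where "s = min 1 (F c / (d + 1))"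
    have s: "0 < s" "s \<le> 1" "s * (d + 1) \<le> F c"
      using pos d mult_right_mono[of s "F c / (d + 1)" "d + 1"] by (auto simp: s_def)
    define c' where "c' = (\<lambda>a'. (1 - s) * c a' + s * (if a' = a then 1 else 0))"
    have "sum c' A = 1"
      using a c A by (simp add: c'_def D_def sum.distrib flip: sum_distrib_left)
    then have "c' \<in> D"
      using c s a by (auto simp: D_def c'_def)
    have v': "v c' i = v c i + s * w i" for i
    proof -
      have "(\<Sum>a'\<in>A. c' a' * a' i) = (1 - s) * (\<Sum>a'\<in>A. c a' * a' i) + s * (\<Sum>a'\<in>A. (if a' = a then 1 else 0) * a' i)"
        unfolding c'_def by (simp only: sum_distrib_left distrib_right sum.distrib mult.assoc)
      also have "(\<Sum>a'\<in>A. (if a' = a then 1 else 0) * a' i) = a i"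
        using a A by (simp add: if_distrib[of "\<lambda>x. x * _"] cong: if_cong)
      finally show ?thesis
        by (simp add: v_def w_def algebra_simps)
    qed
    have "F c' = F c + 2 * s * (\<Sum>i<n. v c i * w i) + s\<^sup>2 * d"
      by (simp add: F_def v' d_def power2_sum power_mult_distrib sum.distrib sum_distrib_left algebra_simps)
    moreover have "(\<Sum>i<n. v c i * w i) = (\<Sum>i<n. v c i * (a i - b i)) - F c"
      by (simp add: F_def w_def power2_eq_square right_diff_distrib sum_subtractf)
    with va have "(\<Sum>i<n. v c i * w i) \<le> - F c"
      by simp
    then have "2 * s * (\<Sum>i<n. v c i * w i) \<le> 2 * s * (- F c)"
      using s by (intro mult_left_mono) auto
    moreover have "s\<^sup>2 * d \<le> s * F c"
    proof -
      have "s * d \<le> F c"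
        using s d by (simp add: algebra_simps)
      then show ?thesis
        using s by (simp add: power2_eq_square mult.assoc)
    qed
    moreover have "0 < s * F c"
      using s pos by simp
    ultimately have "F c' < F c"
      by simp
    with min[OF \<open>c' \<in> D\<close>] show False
      by simp
  qed
  then have "\<forall>i<n. v c i = 0"
    by (simp add: F_def sum_nonneg_eq_0_iff)
  with c show ?thesis
    by (intro exI[of _ c]) (simp add: D_def v_def)
qed


section \<open>Piecewise linear functions\<close>

text \<open>The supremum of the linear combinations, given by its universal property. The same
  notion then applies in X and over the reals, and its behaviour under sums and scaling follows
  because translations and positive multiples preserve the order in both directions.\<close>

definition is_max_lin :: "nat \<Rightarrow> (nat \<Rightarrow> real) set \<Rightarrow> (nat \<Rightarrow> 'a::ordered_real_vector) \<Rightarrow> 'a \<Rightarrow> bool" where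
  "is_max_lin n A x y \<longleftrightarrow> (\<forall>z. y \<le> z \<longleftrightarrow> (\<forall>a\<in>A. lin n a x \<le> z))"

lemma lin_add: "lin n (\<lambda>i. a i + b i) x = lin n a x + lin n b x"
  by (simp add: lin_def scaleR_add_left sum.distrib)

lemma lin_scale: "lin n (\<lambda>i. r * a i) x = r *\<^sub>R lin n a x"
  by (simp add: lin_def scaleR_sum_right)

lemma lin_sum: "lin n (\<lambda>i. \<Sum>a\<in>A. c a * a i) x = (\<Sum>a\<in>A. c a *\<^sub>R lin n a x)"
  by (simp add: lin_def scaleR_sum_left scaleR_sum_right sum.swap[of _ "{..<n}"])

lemma lin_unit: "j < n \<Longrightarrow> lin n (\<lambda>i. if i = j then 1 else 0) x = x j"
  by (simp add: lin_def if_distrib[of "\<lambda>r. r *\<^sub>R _"] cong: if_cong)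

lemma is_max_lin_singleton: "is_max_lin n {a} x (lin n a x)"
  by (simp add: is_max_lin_def)

text \<open>Each summand is moved across the inequality in turn, so that the universal property of
  the other one can be applied.\<close>

lemma is_max_lin_add:
  assumes "is_max_lin n A x y" "is_max_lin n B x z"
  shows "is_max_lin n ((\<lambda>(a, b) i. a i + b i) ` (A \<times> B)) x (y + z)"
  unfolding is_max_lin_def
proof
  fix w
  have "y + z \<le> w \<longleftrightarrow> y \<le> w - z"
    by (simp add: le_diff_eq)
  also have "\<dots> \<longleftrightarrow> (\<forall>a\<in>A. lin n a x \<le> w - z)"
    using assms by (simp add: is_max_lin_def)
  also have "\<dots> \<longleftrightarrow> (\<forall>a\<in>A. z \<le> w - lin n a x)"
    by (simp add: le_diff_eq add.commute)
  also have "\<dots> \<longleftrightarrow> (\<forall>a\<in>A. \<forall>b\<in>B. lin n b x \<le> w - lin n a x)"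
    using assms by (auto simp: is_max_lin_def)
  finally show "y + z \<le> w \<longleftrightarrow> (\<forall>a\<in>(\<lambda>(a, b) i. a i + b i) ` (A \<times> B). lin n a x \<le> w)"
    by (auto simp: lin_add le_diff_eq add.commute)
qed

lemma is_max_lin_scale:
  assumes "is_max_lin n A x y" "0 < r"
  shows "is_max_lin n ((\<lambda>a i. r * a i) ` A) x (r *\<^sub>R y)"
  unfolding is_max_lin_def
proof
  fix w
  have *: "r *\<^sub>R u \<le> w \<longleftrightarrow> u \<le> w /\<^sub>R r" for u :: 'a
    using \<open>0 < r\<close> by (rule pos_le_divideR_eq[symmetric])
  show "r *\<^sub>R y \<le> w \<longleftrightarrow> (\<forall>a\<in>(\<lambda>a i. r * a i) ` A. lin n a x \<le> w)"
    using assms by (simp add: lin_scale * is_max_lin_def)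
qed

lemma is_max_lin_sup:
  fixes x :: "nat \<Rightarrow> 'a::{ordered_real_vector, semilattice_sup}"
  assumes "is_max_lin n A x y" "is_max_lin n B x z"
  shows "is_max_lin n (A \<union> B) x (sup y z)"
  using assms by (auto simp: is_max_lin_def)

lemma is_max_lin_mono:
  fixes x :: "nat \<Rightarrow> 'a::ordered_real_vector"
  assumes B: "finite B" "B \<noteq> {}"
    and A: "is_max_lin n A x y" "\<And>t :: nat \<Rightarrow> real. is_max_lin n A t (p t)"
    and B': "is_max_lin n B x z" "\<And>t. is_max_lin n B t (q t)"
    and le: "\<And>t. p t \<le> q t"
  shows "y \<le> z"
proof -
  have "lin n a x \<le> z" if a: "a \<in> A" for a
  proof -
    have "\<exists>b\<in>B. lin n a t \<le> lin n b t" for t :: "nat \<Rightarrow> real"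
    proof -
      \<comment> \<open>Over the reals the supremum is attained by some \<open>b\<close>, which
        gives the hypothesis of the separation lemma. In X it need not be attained; there only the
        convex combination is used.\<close>
      have "q t \<le> Max ((\<lambda>b. lin n b t) ` B)"
        using B B'(2)[of t] by (simp add: is_max_lin_def)
      moreover have "Max ((\<lambda>b. lin n b t) ` B) \<in> (\<lambda>b. lin n b t) ` B"
        using B by (intro Max_in) auto
      then obtain b where "b \<in> B" "Max ((\<lambda>b. lin n b t) ` B) = lin n b t"
        by (elim imageE)
      moreover have "lin n a t \<le> p t"
        using A(2)[of t] a by (auto simp: is_max_lin_def)
      ultimately show ?thesis
        using le[of t] by (intro bexI[of _ b]) auto
    qed
    then obtain c where c: "\<And>b. b \<in> B \<Longrightarrow> 0 \<le> c b" "sum c B = 1" "\<And>i. i < n \<Longrightarrow> a i = (\<Sum>b\<in>B. c b * b i)"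
      using convex_combination_of_pointwise_le[OF B, of n a] by blast
    have "lin n a x = (\<Sum>b\<in>B. c b *\<^sub>R lin n b x)"
      unfolding lin_sum[symmetric] using c(3) by (simp add: lin_def)
    also have "\<dots> \<le> (\<Sum>b\<in>B. c b *\<^sub>R z)"
      using B'(1) c(1) by (intro sum_mono scaleR_left_mono) (auto simp: is_max_lin_def)
    also have "\<dots> = z"
      using c(2) by (simp flip: scaleR_sum_left)
    finally show ?thesis .
  qed
  with A(1) show ?thesis
    by (simp add: is_max_lin_def)
qed

text \<open>A relation that builds function and value side by side, since it is not yet known that
  the value depends on the function alone.\<close>

inductive piecewise_linear ::
  "nat \<Rightarrow> (nat \<Rightarrow> 'a::banach_lattice) \<Rightarrow> ((nat \<Rightarrow> real) \<Rightarrow> real) \<Rightarrow> 'a \<Rightarrow> bool"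
  for n x where
  zero: "piecewise_linear n x (\<lambda>t. 0) 0"
| proj: "j < n \<Longrightarrow> piecewise_linear n x (\<lambda>t. t j) (x j)"
| add: "piecewise_linear n x g y \<Longrightarrow> piecewise_linear n x h z \<Longrightarrow>
    piecewise_linear n x (\<lambda>t. g t + h t) (y + z)"
| scale: "piecewise_linear n x g y \<Longrightarrow> piecewise_linear n x (\<lambda>t. r * g t) (r *\<^sub>R y)"
| max: "piecewise_linear n x g y \<Longrightarrow> piecewise_linear n x h z \<Longrightarrow>
    piecewise_linear n x (\<lambda>t. max (g t) (h t)) (sup y z)"

text \<open>One finite set \<open>A\<close> has to serve both for \<open>u\<close> in X and for
  \<open>p\<close> at every real tuple. This common certificate is what carries an inequality
  between functions over to X.\<close>

definition sublinear ::
  "nat \<Rightarrow> (nat \<Rightarrow> 'a::banach_lattice) \<Rightarrow> ((nat \<Rightarrow> real) \<Rightarrow> real) \<Rightarrow> 'a \<Rightarrow> bool" where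
  "sublinear n x p u \<longleftrightarrow>
     (\<exists>A. finite A \<and> A \<noteq> {} \<and> is_max_lin n A x u \<and> (\<forall>t. is_max_lin n A t (p t)))"

lemma sublinear_lin: "sublinear n x (lin n a) (lin n a x)"
  unfolding sublinear_def by (rule exI[of _ "{a}"]) (simp add: is_max_lin_singleton)

lemma sublinear_zero: "sublinear n x (\<lambda>t. 0) 0"
  using sublinear_lin[of n x "\<lambda>i. 0"] by (simp add: lin_def[abs_def])

lemma sublinear_add:
  assumes "sublinear n x p u" "sublinear n x q v"
  shows "sublinear n x (\<lambda>t. p t + q t) (u + v)"
proof -
  obtain A B where "finite A" "A \<noteq> {}" "is_max_lin n A x u" "\<forall>t. is_max_lin n A t (p t)"
    "finite B" "B \<noteq> {}" "is_max_lin n B x v" "\<forall>t. is_max_lin n B t (q t)"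
    using assms by (auto simp: sublinear_def)
  then show ?thesis
    unfolding sublinear_def
    by (intro exI[of _ "(\<lambda>(a, b) i. a i + b i) ` (A \<times> B)"]) (auto intro!: is_max_lin_add)
qed

lemma sublinear_scale:
  assumes "sublinear n x p u" "0 \<le> r"
  shows "sublinear n x (\<lambda>t. r * p t) (r *\<^sub>R u)"
proof (cases "r = 0")
  case False
  with \<open>0 \<le> r\<close> have "0 < r"
    by simp
  obtain A where "finite A" "A \<noteq> {}" "is_max_lin n A x u" "\<forall>t. is_max_lin n A t (p t)"
    using assms by (auto simp: sublinear_def)
  then show ?thesis
    unfolding sublinear_def
    using is_max_lin_scale[OF _ \<open>0 < r\<close>, of n A x u] is_max_lin_scale[OF _ \<open>0 < r\<close>, of n A _ "p _"]
    by (intro exI[of _ "(\<lambda>a i. r * a i) ` A"]) simp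
qed (simp add: sublinear_zero)

lemma sublinear_max:
  assumes "sublinear n x p u" "sublinear n x q v"
  shows "sublinear n x (\<lambda>t. max (p t) (q t)) (sup u v)"
proof -
  obtain A B where "finite A" "A \<noteq> {}" "is_max_lin n A x u" "\<forall>t. is_max_lin n A t (p t)"
    "finite B" "B \<noteq> {}" "is_max_lin n B x v" "\<forall>t. is_max_lin n B t (q t)"
    using assms by (auto simp: sublinear_def)
  then show ?thesis
    unfolding sublinear_def
    by (intro exI[of _ "A \<union> B"]) (auto intro!: is_max_lin_sup simp flip: sup_max)
qed

lemma sublinear_mono:
  assumes "sublinear n x p u" "sublinear n x q v" "\<And>t. p t \<le> q t"
  shows "u \<le> v"
proof -
  obtain A B where "is_max_lin n A x u" "\<forall>t. is_max_lin n A t (p t)"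
    "finite B" "B \<noteq> {}" "is_max_lin n B x v" "\<forall>t. is_max_lin n B t (q t)"
    using assms(1,2) by (auto simp: sublinear_def)
  then show ?thesis
    using assms(3) by (intro is_max_lin_mono[of B n A x u p v q]) auto
qed

definition diff_sublinear ::
  "nat \<Rightarrow> (nat \<Rightarrow> 'a::banach_lattice) \<Rightarrow> ((nat \<Rightarrow> real) \<Rightarrow> real) \<Rightarrow> 'a \<Rightarrow> bool" where
  "diff_sublinear n x h y \<longleftrightarrow>
     (\<exists>p q u v. sublinear n x p u \<and> sublinear n x q v \<and> h = (\<lambda>t. p t - q t) \<and> y = u - v)"

lemma diff_sublinearI:
  assumes "sublinear n x p u" "sublinear n x q v" "\<And>t. h t = p t - q t" "y = u - v"
  shows "diff_sublinear n x h y"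
proof -
  have "h = (\<lambda>t. p t - q t)"
    using assms(3) by (rule ext)
  with assms(1,2,4) show ?thesis
    unfolding diff_sublinear_def
    by (intro exI[of _ p] exI[of _ q] exI[of _ u] exI[of _ v] conjI)
qed

text \<open>\<open>max (p - q) (r - s) = max (p + s) (r + q) - (q + s)\<close> keeps the differences of sublinear
  functions closed under maxima.\<close>

lemma piecewise_linear_imp_diff_sublinear:
  assumes "piecewise_linear n x h y"
  shows "diff_sublinear n x h y"
  using assms
proof induction
  case zero
  show ?case
    by (rule diff_sublinearI[OF sublinear_zero sublinear_zero]) auto
next
  case (proj j)
  then show ?case
    by (intro diff_sublinearI[OF sublinear_lin[of n x "\<lambda>i. if i = j then 1 else 0"] sublinear_zero])
      (simp_all add: lin_unit)
next
  case (add g y h z)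
  then obtain p q u v r s w k where *: "sublinear n x p u" "sublinear n x q v"
    "g = (\<lambda>t. p t - q t)" "y = u - v" "sublinear n x r w" "sublinear n x s k"
    "h = (\<lambda>t. r t - s t)" "z = w - k"
    unfolding diff_sublinear_def by blast
  show ?case
    by (rule diff_sublinearI[OF sublinear_add[OF *(1,5)] sublinear_add[OF *(2,6)]])
      (simp_all add: *)
next
  case (scale g y c)
  then obtain p q u v where *: "sublinear n x p u" "sublinear n x q v"
    "g = (\<lambda>t. p t - q t)" "y = u - v"
    unfolding diff_sublinear_def by blast
  show ?case
  proof (cases "0 \<le> c")
    case True
    show ?thesis
      by (rule diff_sublinearI[OF sublinear_scale[OF *(1) True] sublinear_scale[OF *(2) True]])
        (simp_all add: * algebra_simps)
  next
    case False
    then have c: "0 \<le> - c"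
      by simp
    show ?thesis
      by (rule diff_sublinearI[OF sublinear_scale[OF *(2) c] sublinear_scale[OF *(1) c]])
        (simp_all add: * algebra_simps)
  qed
next
  case (max g y h z)
  then obtain p q u v r s w k where *: "sublinear n x p u" "sublinear n x q v"
    "g = (\<lambda>t. p t - q t)" "y = u - v" "sublinear n x r w" "sublinear n x s k"
    "h = (\<lambda>t. r t - s t)" "z = w - k"
    unfolding diff_sublinear_def by blast
  have "sup y z = sup (u + k) (w + v) - (v + k)"
    using add_sup_distrib_left[of "- (v + k)" "u + k" "w + v"] by (simp add: * algebra_simps)
  then show ?case
    by (intro diff_sublinearI[OF sublinear_max[OF sublinear_add[OF *(1,6)] sublinear_add[OF *(5,2)]]
      sublinear_add[OF *(2,6)]]) (auto simp: *)
qed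

text \<open>Nonnegativity of \<open>p - q\<close> says that \<open>q\<close> lies below
  \<open>p\<close>, and these are maxima of linear functions, where separation applies.\<close>

lemma piecewise_linear_nonneg:
  assumes "piecewise_linear n x h y" "\<And>t. 0 \<le> h t"
  shows "0 \<le> y"
proof -
  obtain p q u v where *: "sublinear n x p u" "sublinear n x q v" "h = (\<lambda>t. p t - q t)" "y = u - v"
    using piecewise_linear_imp_diff_sublinear[OF assms(1)]
    unfolding diff_sublinear_def by blast
  have "v \<le> u"
    using assms(2) by (intro sublinear_mono[OF *(2,1)]) (simp add: *)
  then show ?thesis
    by (simp add: *)
qed


section \<open>Further piecewise linear operations\<close>

lemma piecewise_linear_cong:
  "piecewise_linear n x g y \<Longrightarrow> (\<And>t. g t = h t) \<Longrightarrow> y = z \<Longrightarrow> piecewise_linear n x h z"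
  by (metis ext)

lemma piecewise_linear_uminus:
  "piecewise_linear n x g y \<Longrightarrow> piecewise_linear n x (\<lambda>t. - g t) (- y)"
  by (drule piecewise_linear.scale[where r = "-1"]) simp

lemma piecewise_linear_diff:
  "piecewise_linear n x g y \<Longrightarrow> piecewise_linear n x h z \<Longrightarrow>
    piecewise_linear n x (\<lambda>t. g t - h t) (y - z)"
  using piecewise_linear.add[OF _ piecewise_linear_uminus] by fastforce

lemma piecewise_linear_abs:
  "piecewise_linear n x g y \<Longrightarrow> piecewise_linear n x (\<lambda>t. \<bar>g t\<bar>) \<bar>y\<bar>"
  by (rule piecewise_linear_cong[OF piecewise_linear.max[OF _ piecewise_linear_uminus]])
    (auto simp flip: abs_lattice)

lemma piecewise_linear_sum:
  "finite I \<Longrightarrow> (\<And>i. i \<in> I \<Longrightarrow> piecewise_linear n x (g i) (y i)) \<Longrightarrow>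
    piecewise_linear n x (\<lambda>t. \<Sum>i\<in>I. g i t) (\<Sum>i\<in>I. y i)"
proof (induction I rule: finite_induct)
  case (insert i I)
  then show ?case
    using piecewise_linear.add[of n x "g i" "y i"] by simp
qed (simp add: piecewise_linear.zero)

lemma piecewise_linear_Min:
  assumes "finite F" "F \<noteq> {}" "\<And>s. s \<in> F \<Longrightarrow> \<exists>y. piecewise_linear n x (g s) y"
  shows "\<exists>y. piecewise_linear n x (\<lambda>t. Min ((\<lambda>s. g s t) ` F)) y"
  using assms
proof (induction F rule: finite_ne_induct)
  case (insert s F)
  obtain y where "piecewise_linear n x (g s) y"
    using insert.prems by auto
  moreover obtain z where "piecewise_linear n x (\<lambda>t. Min ((\<lambda>s. g s t) ` F)) z"
    using insert by auto
  ultimately have "piecewise_linear n x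
      (\<lambda>t. - max (- g s t) (- Min ((\<lambda>s. g s t) ` F))) (- sup (- y) (- z))"
    by (intro piecewise_linear_uminus piecewise_linear.max)
  moreover have "- max (- g s t) (- Min ((\<lambda>s. g s t) ` F)) = Min ((\<lambda>s. g s t) ` insert s F)" for t
  proof -
    have "- max (- a) (- b) = min a b" for a b :: real
      by (simp add: max_def min_def)
    then show ?thesis
      using insert.hyps by (simp only: image_insert Min_insert finite_imageI image_is_empty not_False_eq_True)
  qed
  ultimately show ?case
    by auto
qed auto

text \<open>The gauge for approximation: piecewise linear itself, and comparable to every function
  in \<open>hom_funs n\<close> by compactness of its unit sphere.\<close>

definition l1norm :: "nat \<Rightarrow> (nat \<Rightarrow> real) \<Rightarrow> real" where
  "l1norm n t = (\<Sum>i<n. \<bar>t i\<bar>)"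

lemma l1norm_nonneg [simp]: "0 \<le> l1norm n t"
  by (simp add: l1norm_def sum_nonneg)

lemma piecewise_linear_l1norm: "piecewise_linear n x (l1norm n) (\<Sum>i<n. \<bar>x i\<bar>)"
  unfolding l1norm_def[abs_def]
  by (intro piecewise_linear_sum piecewise_linear_abs piecewise_linear.proj) auto

lemma norm_abs [simp]: "norm \<bar>x\<bar> = norm x" for x :: "'a::banach_lattice"
  by (intro antisym norm_mono_abs) simp_all

text \<open>Positivity of \<open>e * l1norm n t - h t\<close> and
  \<open>e * l1norm n t + h t\<close> bounds the modulus of \<open>y\<close>. Applied to
  differences, this makes the value Lipschitz in the function; the case \<open>e = 0\<close> says
  that it depends on the function only.\<close>

lemma piecewise_linear_norm_le:
  assumes "piecewise_linear n x h y" "\<And>t. \<bar>h t\<bar> \<le> e * l1norm n t" "0 \<le> e"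
  shows "norm y \<le> e * norm (\<Sum>i<n. \<bar>x i\<bar>)"
proof -
  let ?E = "\<Sum>i<n. \<bar>x i\<bar>"
  have e: "piecewise_linear n x (\<lambda>t. e * l1norm n t) (e *\<^sub>R ?E)"
    by (intro piecewise_linear.scale piecewise_linear_l1norm)
  have "0 \<le> e *\<^sub>R ?E - y" "0 \<le> e *\<^sub>R ?E + y"
    using assms(2) piecewise_linear_nonneg[OF piecewise_linear_diff[OF e assms(1)]]
      piecewise_linear_nonneg[OF piecewise_linear.add[OF e assms(1)]]
    by (auto simp: abs_le_iff) (smt (verit))+
  then have "\<bar>y\<bar> \<le> e *\<^sub>R ?E"
    by (intro abs_leI) (simp_all add: algebra_simps neg_le_iff_le minus_le_iff flip: diff_minus_eq_add)
  then have "norm y \<le> norm (e *\<^sub>R ?E)"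
    by (intro norm_mono_abs) (meson abs_ge_self order_trans)
  with \<open>0 \<le> e\<close> show ?thesis
    by simp
qed

section \<open>Density\<close>

lemma continuous_on_l1norm [continuous_intros]: "continuous_on UNIV (l1norm n)"
  unfolding l1norm_def[abs_def]
  by (intro continuous_intros continuous_on_product_coordinates)

section \<open>Continuous homogeneous functions and the l1-sphere\<close>

lemma hom_funs_continuous: "h \<in> hom_funs n \<Longrightarrow> continuous_on A h"
  by (auto simp: hom_funs_def intro: continuous_on_subset)

lemma hom_funs_scale: "h \<in> hom_funs n \<Longrightarrow> 0 \<le> c \<Longrightarrow> h (\<lambda>i. c * t i) = c * h t"
  by (auto simp: hom_funs_def)

lemma hom_funs_cong: "h \<in> hom_funs n \<Longrightarrow> (\<And>i. i < n \<Longrightarrow> s i = t i) \<Longrightarrow> h s = h t"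
  by (auto simp: hom_funs_def)

lemma hom_funs_proj: "j < n \<Longrightarrow> (\<lambda>t. t j) \<in> hom_funs n"
  by (auto simp: hom_funs_def intro: continuous_on_product_coordinates)

lemma hom_funs_add: "g \<in> hom_funs n \<Longrightarrow> h \<in> hom_funs n \<Longrightarrow> (\<lambda>t. g t + h t) \<in> hom_funs n"
  by (auto simp: hom_funs_def algebra_simps intro!: continuous_intros) metis

lemma hom_funs_mult: "g \<in> hom_funs n \<Longrightarrow> (\<lambda>t. r * g t) \<in> hom_funs n"
  by (auto simp: hom_funs_def algebra_simps intro!: continuous_intros)

lemma hom_funs_max: "g \<in> hom_funs n \<Longrightarrow> h \<in> hom_funs n \<Longrightarrow> (\<lambda>t. max (g t) (h t)) \<in> hom_funs n"
  by (auto simp: hom_funs_def max_mult_distrib_left intro!: continuous_intros) metis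

lemma piecewise_linear_hom_funs: "piecewise_linear n x h y \<Longrightarrow> h \<in> hom_funs n"
proof (induction rule: piecewise_linear.induct)
  case zero
  show ?case
    by (simp add: hom_funs_def)
qed (simp_all add: hom_funs_proj hom_funs_add hom_funs_mult hom_funs_max)

lemma hom_funs_l1norm: "l1norm n \<in> hom_funs n"
  by (auto simp: hom_funs_def continuous_on_l1norm)
    (auto simp: l1norm_def abs_mult sum_distrib_left)

text \<open>The entries from \<open>n\<close> on are fixed at 0, as otherwise the set would not be
  compact in the product topology.\<close>

definition l1sphere :: "nat \<Rightarrow> (nat \<Rightarrow> real) set" where
  "l1sphere n = {t. l1norm n t = 1 \<and> (\<forall>i\<ge>n. t i = 0)}"

lemma compact_l1sphere: "compact (l1sphere n)"
proof -
  have "l1sphere n = Pi\<^sub>E UNIV (\<lambda>i. if i < n then {-1..1} else {0}) \<inter> {t. l1norm n t = 1}" (is "_ = ?P \<inter> ?C")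
  proof (intro equalityI subsetI)
    fix t assume t: "t \<in> l1sphere n"
    have "\<bar>t i\<bar> \<le> 1" if "i < n" for i
      using member_le_sum[of i "{..<n}" "\<lambda>i. \<bar>t i\<bar>"] t that by (auto simp: l1sphere_def l1norm_def)
    with t show "t \<in> ?P \<inter> ?C"
      by (auto simp: PiE_iff l1sphere_def abs_le_iff minus_le_iff)
  next
    fix t assume t: "t \<in> ?P \<inter> ?C"
    then have "t i \<in> (if i < n then {-1..1} else {0})" for i
      by (auto simp: PiE_iff)
    from this[of "_ :: nat"] t show "t \<in> l1sphere n"
      by (force simp: l1sphere_def split: if_splits)
  qed
  moreover have "compact ?P"
    by (rule compact_PiE_fun) auto
  moreover have "closed ?C"
    by (intro closed_Collect_eq continuous_intros)
  ultimately show ?thesis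
    by (simp add: compact_Int_closed)
qed

text \<open>Each tuple agrees in its first \<open>n\<close> entries with a nonnegative multiple of a
  point of the sphere, or has only zeros there, where homogeneity makes both functions
  vanish.\<close>

lemma hom_funs_le_if_le_sphere:
  assumes g: "g \<in> hom_funs n" and h: "h \<in> hom_funs n"
    and le: "\<And>t. t \<in> l1sphere n \<Longrightarrow> g t \<le> h t"
  shows "g t \<le> h t"
proof (cases "l1norm n t = 0")
  case True
  then have "\<And>i. i < n \<Longrightarrow> t i = 0 * t i"
    by (simp add: l1norm_def sum_nonneg_eq_0_iff)
  then have "g t = g (\<lambda>i. 0 * t i)" "h t = h (\<lambda>i. 0 * t i)"
    by (auto intro: hom_funs_cong[OF g] hom_funs_cong[OF h])
  then show ?thesis
    using hom_funs_scale[OF g, of 0 t] hom_funs_scale[OF h, of 0 t] by simp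
next
  case False
  define r where "r = l1norm n t"
  have r: "r > 0"
    using False by (simp add: r_def order_less_le)
  define s where "s i = (if i < n then t i / r else 0)" for i
  have "l1norm n s = l1norm n t / r"
    using r by (simp add: l1norm_def s_def sum_divide_distrib)
  then have "s \<in> l1sphere n"
    using r by (simp add: l1sphere_def r_def[symmetric]) (simp add: s_def)
  then have "r * g s \<le> r * h s"
    using le r by (intro mult_left_mono) auto
  moreover have "g t = g (\<lambda>i. r * s i)" "h t = h (\<lambda>i. r * s i)"
    using r by (auto intro!: hom_funs_cong[OF g] hom_funs_cong[OF h] simp: s_def)
  ultimately show ?thesis
    using r by (simp add: hom_funs_scale[OF g] hom_funs_scale[OF h])
qed

text \<open>A homogeneous version of McShane's formula \<open>inf\<^sub>s h s + M * dist s t\<close>, where the constant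
  depends on \<open>s\<close> and compactness makes the infimum finite.\<close>

lemma piecewise_linear_dense:
  fixes x :: "nat \<Rightarrow> 'a::banach_lattice"
  assumes h: "h \<in> hom_funs n" and e: "0 < e"
  shows "\<exists>f y. piecewise_linear n x f y \<and> (\<forall>t. \<bar>f t - h t\<bar> \<le> e * l1norm n t)"
proof -
  let ?S = "l1sphere n"
  \<comment> \<open>For \<open>t\<close> on the sphere this is the l1-distance to \<open>s\<close>.
    The factor \<open>l1norm n t\<close> makes it positively homogeneous in \<open>t\<close> and
    keeps it piecewise linear.\<close>
  define d where "d s t = (\<Sum>i<n. \<bar>t i - s i * l1norm n t\<bar>)" for s t :: "nat \<Rightarrow> real"
  have cont_d: "continuous_on A (d s)" for A s
    unfolding d_def
    by (intro continuous_intros continuous_on_subset[OF continuous_on_product_coordinates]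
        continuous_on_subset[OF continuous_on_l1norm]) auto
  have pl_d: "\<exists>y. piecewise_linear n x (d s) y" for s
  proof -
    have *: "piecewise_linear n x (\<lambda>t. \<bar>t i - s i * l1norm n t\<bar>) \<bar>x i - s i *\<^sub>R (\<Sum>i<n. \<bar>x i\<bar>)\<bar>"
      if "i \<in> {..<n}" for i
      using that by (intro piecewise_linear_abs piecewise_linear_diff piecewise_linear.proj
          piecewise_linear.scale piecewise_linear_l1norm) auto
    show ?thesis
      unfolding d_def
      by (rule exI[where x = "\<Sum>i<n. \<bar>x i - s i *\<^sub>R (\<Sum>i<n. \<bar>x i\<bar>)\<bar>"]) (rule piecewise_linear_sum[OF finite_lessThan *])
  qed
  have "\<exists>M\<ge>0. \<forall>t\<in>?S. h t \<le> h s + e / 2 + M * d s t" if s: "s \<in> ?S" for s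
  proof -
    \<comment> \<open>The bound needs a positive \<open>M\<close> only where \<open>h\<close>
      exceeds \<open>h s\<close> by at least \<open>e / 2\<close>. That part of the sphere is
      compact and avoids \<open>s\<close>, so \<open>d s\<close> is positive on it and the quotient
      is bounded.\<close>
    let ?K = "?S \<inter> {t. h s + e / 2 \<le> h t}"
    have "compact ?K"
      by (intro compact_Int_closed compact_l1sphere closed_Collect_le hom_funs_continuous[OF h]
          continuous_on_const)
    have pos: "0 < d s t" if "t \<in> ?K" for t
    proof -
      have "d s t \<noteq> 0"
      proof
        assume "d s t = 0"
        then have "\<forall>i<n. t i = s i"
          using that by (simp add: d_def sum_nonneg_eq_0_iff l1sphere_def)
        then have "h t = h s"
          by (intro hom_funs_cong[OF h]) auto
        with that e show False
          by simp
      qed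
      moreover have "0 \<le> d s t"
        by (simp add: d_def sum_nonneg)
      ultimately show ?thesis
        by simp
    qed
    have "\<exists>M. \<forall>t\<in>?K. (h t - h s) / d s t \<le> M"
    proof (cases "?K = {}")
      case False
      have "continuous_on ?K (\<lambda>t. (h t - h s) / d s t)"
        by (intro continuous_intros hom_funs_continuous[OF h] cont_d) (use pos in force)
      from continuous_attains_sup[OF \<open>compact ?K\<close> False this] show ?thesis
        by blast
    qed auto
    then obtain M where M: "\<And>t. t \<in> ?K \<Longrightarrow> (h t - h s) / d s t \<le> M"
      by blast
    have "h t \<le> h s + e / 2 + max 0 M * d s t" if "t \<in> ?S" for t
    proof (cases "t \<in> ?K")
      case True
      then have "h t - h s \<le> M * d s t"
        using M[OF True] pos[OF True] by (simp add: pos_divide_le_eq)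
      also have "\<dots> \<le> max 0 M * d s t"
        using pos[OF True] by (intro mult_right_mono) auto
      finally show ?thesis
        using e by simp
    next
      case False
      moreover have "0 \<le> max 0 M * d s t"
        by (simp add: d_def sum_nonneg)
      ultimately show ?thesis
        using that by auto
    qed
    then show ?thesis
      by (intro exI[of _ "max 0 M"]) auto
  qed
  then obtain M where M: "\<And>s t. s \<in> ?S \<Longrightarrow> t \<in> ?S \<Longrightarrow> h t \<le> h s + e / 2 + M s * d s t"
    by metis
  \<comment> \<open>On the sphere \<open>f s\<close> lies above \<open>h\<close>, and at
    \<open>s\<close> it equals \<open>h s + e / 2\<close>, so it stays below \<open>h + e\<close>
    near \<open>s\<close>. By compactness finitely many of these suffice, and their minimum is
    within \<open>e\<close> of \<open>h\<close>.\<close>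
  define f where "f s t = (h s + e / 2) * l1norm n t + M s * d s t" for s t
  have pl_f: "\<exists>y. piecewise_linear n x (f s) y" for s
  proof -
    obtain y where "piecewise_linear n x (d s) y"
      using pl_d by blast
    then show ?thesis
      unfolding f_def
      by (intro exI[of _ "(h s + e / 2) *\<^sub>R (\<Sum>i<n. \<bar>x i\<bar>) + M s *\<^sub>R y"] piecewise_linear.add
          piecewise_linear.scale piecewise_linear_l1norm)
  qed
  have f_ge: "h t \<le> f s t" if "s \<in> ?S" "t \<in> ?S" for s t
    using M[OF that] that by (simp add: f_def l1sphere_def)
  have cont_f: "continuous_on UNIV (f s)" for s
    using pl_f[of s] piecewise_linear_hom_funs hom_funs_continuous by blast
  have cover: "?S \<subseteq> (\<Union>s\<in>?S. {t. f s t < h t + e})"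
    using e by (auto simp: f_def d_def l1sphere_def)
  have "open {t. f s t < h t + e}" if "s \<in> ?S" for s
    by (intro open_Collect_less cont_f continuous_intros hom_funs_continuous[OF h])
  from compactE_image[OF compact_l1sphere this cover]
  obtain F where F: "F \<subseteq> ?S" "finite F" "?S \<subseteq> (\<Union>s\<in>F. {t. f s t < h t + e})"
    by blast
  have "\<exists>g y. piecewise_linear n x g y \<and> (\<forall>t\<in>?S. h t \<le> g t \<and> g t \<le> h t + e)"
  proof (cases "F = {}")
    \<comment> \<open>An empty cover means an empty sphere, which happens for \<open>n = 0\<close>;
      the zero function will do.\<close>
    case True
    then show ?thesis
      using F piecewise_linear.zero by blast
  next
    case False
    obtain y where "piecewise_linear n x (\<lambda>t. Min ((\<lambda>s. f s t) ` F)) y"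
      using piecewise_linear_Min[OF F(2) False] pl_f by blast
    moreover have "h t \<le> Min ((\<lambda>s. f s t) ` F) \<and> Min ((\<lambda>s. f s t) ` F) \<le> h t + e" if "t \<in> ?S" for t
    proof
      show "h t \<le> Min ((\<lambda>s. f s t) ` F)"
        using F False f_ge that by auto
      obtain s where "s \<in> F" "f s t < h t + e"
        using F(3) \<open>t \<in> ?S\<close> by auto
      then show "Min ((\<lambda>s. f s t) ` F) \<le> h t + e"
        using F by (intro order_trans[OF Min_le[of _ "f s t"]]) auto
    qed
    ultimately show ?thesis
      by (intro exI[of _ "\<lambda>t. Min ((\<lambda>s. f s t) ` F)"]) auto
  qed
  then obtain g y where g: "piecewise_linear n x g y" "\<And>t. t \<in> ?S \<Longrightarrow> h t \<le> g t" "\<And>t. t \<in> ?S \<Longrightarrow> g t \<le> h t + e"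
    by blast
  note g_hom = piecewise_linear_hom_funs[OF g(1)]
  have "\<bar>g t - h t\<bar> \<le> e * l1norm n t" for t
  proof -
    have "h t \<le> g t"
      by (rule hom_funs_le_if_le_sphere[OF h g_hom g(2)])
    moreover have "g t \<le> h t + e * l1norm n t"
    proof (rule hom_funs_le_if_le_sphere[OF g_hom])
      show "(\<lambda>t. h t + e * l1norm n t) \<in> hom_funs n"
        by (intro hom_funs_add h hom_funs_mult hom_funs_l1norm)
      show "g t \<le> h t + e * l1norm n t" if "t \<in> l1sphere n" for t
        using g(3)[OF that] that by (simp add: l1sphere_def)
    qed
    ultimately show ?thesis
      by (simp add: abs_le_iff)
  qed
  with g(1) show ?thesis
    by blast
qed


section \<open>Existence and uniqueness of the functional calculus\<close>

text \<open>Makes the supremum Lipschitz in X and, applied entrywise, in the sequence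
  spaces.\<close>

lemma sup_diff_le:
  fixes a b c d :: "'a::banach_lattice"
  shows "\<bar>sup a b - sup c d\<bar> \<le> \<bar>a - c\<bar> + \<bar>b - d\<bar>"
proof -
  have *: "sup a b - sup c d \<le> \<bar>a - c\<bar> + \<bar>b - d\<bar>" for a b c d :: 'a
  proof -
    have "a - c \<le> \<bar>a - c\<bar> + \<bar>b - d\<bar>" "b - d \<le> \<bar>a - c\<bar> + \<bar>b - d\<bar>"
      by (simp_all add: add_increasing add_increasing2 abs_ge_self)
    then have "a \<le> \<bar>a - c\<bar> + \<bar>b - d\<bar> + c" "b \<le> \<bar>a - c\<bar> + \<bar>b - d\<bar> + d"
      by (simp_all only: diff_le_eq)
    then have "sup a b \<le> \<bar>a - c\<bar> + \<bar>b - d\<bar> + sup c d"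
      by (meson add_left_mono le_supI order_trans sup_ge1 sup_ge2)
    then show ?thesis
      by (simp only: diff_le_eq)
  qed
  from *[of c d a b] show ?thesis
    by (intro abs_leI *) (simp only: minus_diff_eq abs_minus_commute)
qed

lemma norm_sup_diff_le:
  fixes a b c d :: "'a::banach_lattice"
  shows "norm (sup a b - sup c d) \<le> norm (a - c) + norm (b - d)"
proof -
  have "norm (sup a b - sup c d) \<le> norm (\<bar>a - c\<bar> + \<bar>b - d\<bar>)"
    by (intro norm_mono_abs order_trans[OF sup_diff_le abs_ge_self])
  also have "\<dots> \<le> norm (a - c) + norm (b - d)"
    by (rule order_trans[OF norm_triangle_ineq]) simp
  finally show ?thesis .
qed

lemma nonpos_if_le_small_mult:
  fixes a C :: real
  assumes "\<And>e. 0 < e \<Longrightarrow> a \<le> e * C"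
  shows "a \<le> 0"
proof (rule ccontr)
  assume "\<not> a \<le> 0"
  then have "0 < a / (2 * (\<bar>C\<bar> + 1))"
    by simp
  note assms[OF this]
  also have "a / (2 * (\<bar>C\<bar> + 1)) * C \<le> a / (2 * (\<bar>C\<bar> + 1)) * (\<bar>C\<bar> + 1)"
    using \<open>\<not> a \<le> 0\<close> by (intro mult_left_mono) auto
  also have "\<dots> = a / 2"
    by (simp add: field_simps)
  finally show False
    using \<open>\<not> a \<le> 0\<close> by simp
qed

text \<open>The closure of the piecewise linear calculus, with one \<open>e\<close> controlling
  function and value. As a relation it involves no choice of approximating sequence, so the rules
  for sums and maxima can combine arbitrary approximants.\<close>

definition calculus_graph ::
  "nat \<Rightarrow> (nat \<Rightarrow> 'a::banach_lattice) \<Rightarrow> ((nat \<Rightarrow> real) \<Rightarrow> real) \<Rightarrow> 'a \<Rightarrow> bool" where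
  "calculus_graph n x h y \<longleftrightarrow>
     (\<forall>e>0. \<exists>f z. piecewise_linear n x f z \<and> (\<forall>t. \<bar>f t - h t\<bar> \<le> e * l1norm n t) \<and> norm (z - y) \<le> e)"

lemma calculus_graphD:
  assumes "calculus_graph n x h y" "0 < e"
  shows "\<exists>f z. piecewise_linear n x f z \<and> (\<forall>t. \<bar>f t - h t\<bar> \<le> e * l1norm n t) \<and> norm (z - y) \<le> e"
  using assms unfolding calculus_graph_def by blast

lemma calculus_graph_piecewise_linear: "piecewise_linear n x h y \<Longrightarrow> calculus_graph n x h y"
  unfolding calculus_graph_def by (auto intro!: exI[of _ h] exI[of _ y])

text \<open>Two approximants of \<open>h\<close> differ by at most \<open>2 * e\<close> times the
  l1-norm, so the Lipschitz bound forces their values together.\<close>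

lemma calculus_graph_unique:
  assumes "calculus_graph n x h y" "calculus_graph n x h z"
  shows "y = z"
proof -
  let ?E = "norm (\<Sum>i<n. \<bar>x i\<bar>)"
  have "norm (y - z) \<le> e * (2 + 2 * ?E)" if e: "0 < e" for e
  proof -
    obtain f u where f: "piecewise_linear n x f u" "\<And>t. \<bar>f t - h t\<bar> \<le> e * l1norm n t" "norm (u - y) \<le> e"
      using calculus_graphD[OF assms(1) e] by blast
    obtain g v where g: "piecewise_linear n x g v" "\<And>t. \<bar>g t - h t\<bar> \<le> e * l1norm n t" "norm (v - z) \<le> e"
      using calculus_graphD[OF assms(2) e] by blast
    have "\<bar>f t - g t\<bar> \<le> (2 * e) * l1norm n t" for t
      using f(2)[of t] g(2)[of t] by (simp add: algebra_simps)
    then have "norm (u - v) \<le> (2 * e) * ?E"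
      using e by (intro piecewise_linear_norm_le[OF piecewise_linear_diff[OF f(1) g(1)]]) auto
    moreover have "norm (y - z) \<le> norm (u - y) + norm (u - v) + norm (v - z)"
      using norm_triangle_ineq[of "(y - u) + (u - v)" "v - z"] norm_triangle_ineq[of "y - u" "u - v"]
      by (simp add: norm_minus_commute)
    ultimately show ?thesis
      using f(3) g(3) by (simp add: algebra_simps)
  qed
  from nonpos_if_le_small_mult[OF this] show ?thesis
    by simp
qed

text \<open>The Lipschitz bound turns approximants from the density lemma into a Cauchy sequence of
  values; here X has to be complete.\<close>

lemma calculus_graph_exists:
  fixes x :: "nat \<Rightarrow> 'a::banach_lattice"
  assumes h: "h \<in> hom_funs n"
  shows "\<exists>y. calculus_graph n x h y"
proof -
  let ?E = "norm (\<Sum>i<n. \<bar>x i\<bar>)"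
  define \<delta> where "\<delta> k = inverse (real (Suc k))" for k
  have \<delta>: "0 < \<delta> k" for k
    by (simp add: \<delta>_def)
  have \<delta>_lim: "\<delta> \<longlonglongrightarrow> 0"
    unfolding \<delta>_def[abs_def] by (rule LIMSEQ_inverse_real_of_nat)
  have "\<forall>k. \<exists>f y. piecewise_linear n x f y \<and> (\<forall>t. \<bar>f t - h t\<bar> \<le> \<delta> k * l1norm n t)"
    using piecewise_linear_dense[OF h \<delta>] by blast
  then obtain f y where f: "\<And>k. piecewise_linear n x (f k) (y k)"
    "\<And>k t. \<bar>f k t - h t\<bar> \<le> \<delta> k * l1norm n t"
    by metis
  have diff: "norm (y k - y m) \<le> (\<delta> k + \<delta> m) * ?E" for k m
  proof (rule piecewise_linear_norm_le[OF piecewise_linear_diff[OF f(1) f(1)]])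
    show "\<bar>f k t - f m t\<bar> \<le> (\<delta> k + \<delta> m) * l1norm n t" for t
      using f(2)[of k t] f(2)[of m t] by (simp add: algebra_simps)
  qed (use \<delta> in \<open>simp add: less_imp_le\<close>)
  have "Cauchy y"
  proof (rule CauchyI)
    fix e :: real assume e: "0 < e"
    have "(\<lambda>k. \<delta> k * ?E) \<longlonglongrightarrow> 0 * ?E"
      by (intro tendsto_intros \<delta>_lim)
    then have "\<forall>\<^sub>F k in sequentially. \<delta> k * ?E < e / 2"
      using e by (intro order_tendstoD) auto
    then obtain M where M: "\<And>k. k \<ge> M \<Longrightarrow> \<delta> k * ?E < e / 2"
      by (auto simp: eventually_sequentially)
    have "norm (y k - y m) < e" if "k \<ge> M" "m \<ge> M" for k m
      using diff[of k m] M[OF that(1)] M[OF that(2)] by (simp add: algebra_simps)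
    then show "\<exists>M. \<forall>m\<ge>M. \<forall>n\<ge>M. norm (y m - y n) < e"
      by blast
  qed
  then obtain z where z: "y \<longlonglongrightarrow> z"
    by (auto simp: Cauchy_convergent_iff convergent_def)
  have "calculus_graph n x h z"
    unfolding calculus_graph_def
  proof (intro allI impI)
    fix e :: real assume e: "0 < e"
    have "\<forall>\<^sub>F k in sequentially. \<delta> k < e \<and> dist (y k) z < e"
      using e by (intro eventually_conj order_tendstoD(2)[OF \<delta>_lim] tendstoD[OF z])
    then obtain k where k: "\<delta> k < e" "dist (y k) z < e"
      by (auto simp: eventually_sequentially)
    have "\<bar>f k t - h t\<bar> \<le> e * l1norm n t" for t
      using k(1) by (intro order_trans[OF f(2)] mult_right_mono) auto
    with f(1) k(2) show "\<exists>f z'. piecewise_linear n x f z' \<and> (\<forall>t. \<bar>f t - h t\<bar> \<le> e * l1norm n t) \<and> norm (z' - z) \<le> e"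
      by (intro exI[of _ "f k"] exI[of _ "y k"]) (auto simp: dist_norm)
  qed
  then show ?thesis ..
qed

lemma calculus_graph_add:
  assumes "calculus_graph n x g y" "calculus_graph n x h z"
  shows "calculus_graph n x (\<lambda>t. g t + h t) (y + z)"
  unfolding calculus_graph_def
proof (intro allI impI)
  fix e :: real assume "0 < e"
  then have e: "0 < e / 2"
    by simp
  obtain f u where f: "piecewise_linear n x f u" "\<And>t. \<bar>f t - g t\<bar> \<le> e / 2 * l1norm n t" "norm (u - y) \<le> e / 2"
    using calculus_graphD[OF assms(1) e] by blast
  obtain k v where k: "piecewise_linear n x k v" "\<And>t. \<bar>k t - h t\<bar> \<le> e / 2 * l1norm n t" "norm (v - z) \<le> e / 2"
    using calculus_graphD[OF assms(2) e] by blast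
  have "\<bar>f t + k t - (g t + h t)\<bar> \<le> e * l1norm n t" for t
    using f(2)[of t] k(2)[of t] by linarith
  moreover have "norm (u + v - (y + z)) \<le> e"
    using norm_diff_triangle_ineq[of u v y z] f(3) k(3) by simp
  ultimately show "\<exists>f' z'. piecewise_linear n x f' z' \<and> (\<forall>t. \<bar>f' t - (g t + h t)\<bar> \<le> e * l1norm n t) \<and> norm (z' - (y + z)) \<le> e"
    using piecewise_linear.add[OF f(1) k(1)] by blast
qed

lemma calculus_graph_max:
  assumes "calculus_graph n x g y" "calculus_graph n x h z"
  shows "calculus_graph n x (\<lambda>t. max (g t) (h t)) (sup y z)"
  unfolding calculus_graph_def
proof (intro allI impI)
  fix e :: real assume "0 < e"
  then have e: "0 < e / 2"
    by simp
  obtain f u where f: "piecewise_linear n x f u" "\<And>t. \<bar>f t - g t\<bar> \<le> e / 2 * l1norm n t" "norm (u - y) \<le> e / 2"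
    using calculus_graphD[OF assms(1) e] by blast
  obtain k v where k: "piecewise_linear n x k v" "\<And>t. \<bar>k t - h t\<bar> \<le> e / 2 * l1norm n t" "norm (v - z) \<le> e / 2"
    using calculus_graphD[OF assms(2) e] by blast
  have "\<bar>max (f t) (k t) - max (g t) (h t)\<bar> \<le> e * l1norm n t" for t
  proof -
    have "\<bar>max a b - max c d\<bar> \<le> \<bar>a - c\<bar> + \<bar>b - d\<bar>" for a b c d :: real
      by (simp add: max_def abs_if)
    from this[of "f t" "k t" "g t" "h t"] show ?thesis
      using f(2)[of t] k(2)[of t] by linarith
  qed
  moreover have "norm (sup u v - sup y z) \<le> e"
    using norm_sup_diff_le[of u v y z] f(3) k(3) by simp
  ultimately show "\<exists>f' z'. piecewise_linear n x f' z' \<and> (\<forall>t. \<bar>f' t - max (g t) (h t)\<bar> \<le> e * l1norm n t) \<and> norm (z' - sup y z) \<le> e"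
    using piecewise_linear.max[OF f(1) k(1)] by blast
qed

lemma calculus_graph_scale:
  assumes "calculus_graph n x g y"
  shows "calculus_graph n x (\<lambda>t. r * g t) (r *\<^sub>R y)"
  unfolding calculus_graph_def
proof (intro allI impI)
  fix e :: real assume "0 < e"
  define d where "d = e / (\<bar>r\<bar> + 1)"
  have d: "0 < d" "\<bar>r\<bar> * d \<le> e"
    using \<open>0 < e\<close> by (auto simp: d_def field_simps)
  obtain f u where f: "piecewise_linear n x f u" "\<And>t. \<bar>f t - g t\<bar> \<le> d * l1norm n t" "norm (u - y) \<le> d"
    using calculus_graphD[OF assms(1) d(1)] by blast
  have "\<bar>r * f t - r * g t\<bar> \<le> e * l1norm n t" for t
  proof -
    have "\<bar>r * f t - r * g t\<bar> \<le> \<bar>r\<bar> * (d * l1norm n t)"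
      using f(2)[of t] by (simp add: abs_mult mult_left_mono flip: right_diff_distrib)
    also have "\<dots> \<le> e * l1norm n t"
      using d(2) by (simp add: mult_right_mono flip: mult.assoc)
    finally show ?thesis .
  qed
  moreover have "norm (r *\<^sub>R u - r *\<^sub>R y) \<le> e"
    using f(3) d by (simp flip: scaleR_diff_right) (meson abs_ge_zero mult_left_mono order_trans)
  ultimately show "\<exists>f' z'. piecewise_linear n x f' z' \<and> (\<forall>t. \<bar>f' t - r * g t\<bar> \<le> e * l1norm n t) \<and> norm (z' - r *\<^sub>R y) \<le> e"
    using piecewise_linear.scale[OF f(1)] by blast
qed

lemma is_krivine_calculus_scale:
  "is_krivine_calculus n x \<tau> \<Longrightarrow> h \<in> hom_funs n \<Longrightarrow> \<tau> (\<lambda>t. r * h t) = r *\<^sub>R \<tau> h"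
  by (simp add: is_krivine_calculus_def)

lemma is_krivine_calculus_piecewise_linear:
  assumes \<tau>: "is_krivine_calculus n x \<tau>" and "piecewise_linear n x h y"
  shows "\<tau> h = y"
  using assms(2)
proof induction
  case zero
  have "(\<lambda>t. 0) \<in> hom_funs n"
    by (simp add: hom_funs_def)
  from is_krivine_calculus_scale[OF \<tau> this, of 0] show ?case
    by simp
qed (use \<tau> in \<open>simp_all add: is_krivine_calculus_def piecewise_linear_hom_funs\<close>)

lemma is_krivine_calculus_mono:
  assumes \<tau>: "is_krivine_calculus n x \<tau>" and "g \<in> hom_funs n" "h \<in> hom_funs n" "\<And>t. g t \<le> h t"
  shows "\<tau> g \<le> \<tau> h"
proof -
  have "\<tau> (\<lambda>t. max (g t) (h t)) = sup (\<tau> g) (\<tau> h)"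
    using assms(1-3) unfolding is_krivine_calculus_def by blast
  moreover have "(\<lambda>t. max (g t) (h t)) = h"
    using assms(4) by (auto simp: max_def)
  ultimately show ?thesis
    by (metis sup_ge1)
qed

text \<open>Preserving maxima makes \<open>\<tau>\<close> monotone, and monotonicity acts as
  continuity: enclosing \<open>h\<close> between \<open>f - d * l1norm n\<close> and
  \<open>f + d * l1norm n\<close> encloses \<open>\<tau> h\<close>, while the value at
  \<open>f\<close> is forced by the axioms. Hence every calculus is contained in the single-valued
  graph.\<close>

lemma is_krivine_calculus_imp_graph:
  assumes \<tau>: "is_krivine_calculus n x \<tau>" and h: "h \<in> hom_funs n"
  shows "calculus_graph n x h (\<tau> h)"
  unfolding calculus_graph_def
proof (intro allI impI)
  fix e :: real assume e: "0 < e"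
  let ?E = "\<Sum>i<n. \<bar>x i\<bar>"
  \<comment> \<open>Chosen so that both \<open>d\<close> and \<open>d * norm ?E\<close> are at most
    \<open>e\<close>; the added 1 covers \<open>?E = 0\<close>.\<close>
  define d where "d = e / (norm ?E + 1)"
  have d: "0 < d" "d * norm ?E \<le> e" "d \<le> e"
    using e by (auto simp: d_def field_simps add_pos_nonneg)
  obtain f z where f: "piecewise_linear n x f z" "\<And>t. \<bar>f t - h t\<bar> \<le> d * l1norm n t"
    using piecewise_linear_dense[OF h d(1), of x] by blast
  note hom = piecewise_linear_hom_funs[OF f(1)] h hom_funs_mult[OF hom_funs_l1norm]
  have E: "\<tau> (\<lambda>t. d * l1norm n t) = d *\<^sub>R ?E"
    by (rule is_krivine_calculus_piecewise_linear[OF \<tau>])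
      (intro piecewise_linear.scale piecewise_linear_l1norm)
  have add: "\<tau> (\<lambda>t. g t + d * l1norm n t) = \<tau> g + d *\<^sub>R ?E" if "g \<in> hom_funs n" for g
    using \<tau> that hom E by (simp add: is_krivine_calculus_def)
  have "\<tau> f \<le> \<tau> (\<lambda>t. h t + d * l1norm n t)" "\<tau> h \<le> \<tau> (\<lambda>t. f t + d * l1norm n t)"
    by (rule is_krivine_calculus_mono[OF \<tau>], intro hom hom_funs_add, intro hom hom_funs_add,
        use f(2) in \<open>simp add: abs_le_iff algebra_simps\<close>)+
  then have "\<bar>\<tau> f - \<tau> h\<bar> \<le> d *\<^sub>R ?E"
    by (intro abs_leI) (simp_all add: add hom diff_le_eq add.commute)
  then have "norm (\<tau> f - \<tau> h) \<le> norm (d *\<^sub>R ?E)"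
    by (intro norm_mono_abs) (meson abs_ge_self order_trans)
  then have "norm (\<tau> f - \<tau> h) \<le> e"
    using d by simp
  moreover have "\<tau> f = z"
    by (rule is_krivine_calculus_piecewise_linear[OF \<tau> f(1)])
  moreover have "\<bar>f t - h t\<bar> \<le> e * l1norm n t" for t
    using d(3) by (intro order_trans[OF f(2)] mult_right_mono) auto
  ultimately show "\<exists>f z. piecewise_linear n x f z \<and> (\<forall>t. \<bar>f t - h t\<bar> \<le> e * l1norm n t) \<and> norm (z - \<tau> h) \<le> e"
    using f(1) by blast
qed

lemma is_krivine_calculus_unique:
  assumes "is_krivine_calculus n x \<sigma>" "is_krivine_calculus n x \<tau>"
  shows "\<sigma> = \<tau>"
proof (rule extensionalityI[of _ "hom_funs n"])
  show "\<sigma> \<in> extensional (hom_funs n)" "\<tau> \<in> extensional (hom_funs n)"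
    using assms by (auto simp: is_krivine_calculus_def)
  show "\<sigma> h = \<tau> h" if "h \<in> hom_funs n" for h
    using calculus_graph_unique is_krivine_calculus_imp_graph assms that by blast
qed

text \<open>Pick values from the graph. Each axiom holds because the graph contains the combined
  value at the combined function and is single-valued.\<close>

lemma is_krivine_calculus_exists:
  fixes x :: "nat \<Rightarrow> 'a::banach_lattice"
  shows "\<exists>\<tau>. is_krivine_calculus n x \<tau>"
proof -
  have "\<forall>h\<in>hom_funs n. \<exists>y. calculus_graph n x h y"
    using calculus_graph_exists by blast
  from bchoice[OF this] obtain \<sigma> where \<sigma>: "\<And>h. h \<in> hom_funs n \<Longrightarrow> calculus_graph n x h (\<sigma> h)"
    by blast
  have eq: "\<sigma> h = y" if "h \<in> hom_funs n" "calculus_graph n x h y" for h y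
    using calculus_graph_unique \<sigma> that by blast
  have "is_krivine_calculus n x (restrict \<sigma> (hom_funs n))"
    unfolding is_krivine_calculus_def
    by (auto simp: hom_funs_add hom_funs_mult hom_funs_max hom_funs_proj
        intro!: eq calculus_graph_add calculus_graph_scale calculus_graph_max \<sigma>
          calculus_graph_piecewise_linear[OF piecewise_linear.proj])
  then show ?thesis
    by (rule exI[of _ "restrict \<sigma> (hom_funs n)"])
qed

lemma krivine_calculus: "is_krivine_calculus n x (krivine n x)"
proof -
  have "\<exists>!\<tau>. is_krivine_calculus n x \<tau>"
    using is_krivine_calculus_exists is_krivine_calculus_unique by (rule ex_ex1I)
  then show ?thesis
    unfolding krivine_def by (rule theI')
qed

lemma krivine_eqI: "is_krivine_calculus n x \<tau> \<Longrightarrow> krivine n x = \<tau>"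
  by (rule is_krivine_calculus_unique[OF krivine_calculus])

section \<open>Rules for the calculus\<close>

lemma krivine_add:
  "g \<in> hom_funs n \<Longrightarrow> h \<in> hom_funs n \<Longrightarrow> krivine n x (\<lambda>t. g t + h t) = krivine n x g + krivine n x h"
  using krivine_calculus[of n x] by (simp add: is_krivine_calculus_def)

lemma krivine_scale:
  "h \<in> hom_funs n \<Longrightarrow> krivine n x (\<lambda>t. r * h t) = r *\<^sub>R krivine n x h"
  using krivine_calculus[of n x] by (simp add: is_krivine_calculus_def)

lemma krivine_proj: "j < n \<Longrightarrow> krivine n x (\<lambda>t. t j) = x j"
  using krivine_calculus[of n x] by (simp add: is_krivine_calculus_def)

lemma krivine_max:
  "g \<in> hom_funs n \<Longrightarrow> h \<in> hom_funs n \<Longrightarrow>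
    krivine n x (\<lambda>t. max (g t) (h t)) = sup (krivine n x g) (krivine n x h)"
  using krivine_calculus[of n x] by (simp add: is_krivine_calculus_def)

lemma krivine_mono:
  "g \<in> hom_funs n \<Longrightarrow> h \<in> hom_funs n \<Longrightarrow> (\<And>t. g t \<le> h t) \<Longrightarrow> krivine n x g \<le> krivine n x h"
  by (rule is_krivine_calculus_mono[OF krivine_calculus])

lemma krivine_piecewise_linear: "piecewise_linear n x h y \<Longrightarrow> krivine n x h = y"
  by (rule is_krivine_calculus_piecewise_linear[OF krivine_calculus])


section \<open>Composition of calculi\<close>

lemma continuous_on_restricted_tuple:
  assumes "\<And>i. i < n \<Longrightarrow> g i \<in> hom_funs m"
  shows "continuous_on UNIV (\<lambda>t i. if i < n then g i t else 0)"
proof (rule continuous_on_coordinatewise_then_product)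
  show "continuous_on UNIV (\<lambda>t. if i < n then g i t else 0)" for i
    using hom_funs_continuous[OF assms] by (cases "i < n") auto
qed

text \<open>The inner tuple is cut off at \<open>n\<close> because \<open>g i\<close> is known to be
  continuous only for \<open>i < n\<close>, and continuity into the product concerns all entries.
  Since \<open>h\<close> ignores the later entries, the cut does not change its values.\<close>

lemma hom_funs_compose:
  assumes h: "h \<in> hom_funs n" and g: "\<And>i. i < n \<Longrightarrow> g i \<in> hom_funs m"
  shows "(\<lambda>t. h (\<lambda>i. if i < n then g i t else 0)) \<in> hom_funs m"
  unfolding hom_funs_def
proof (intro CollectI conjI allI impI)
  show "continuous_on UNIV (\<lambda>t. h (\<lambda>i. if i < n then g i t else 0))"
    by (rule continuous_on_compose2[OF hom_funs_continuous[OF h, of UNIV]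
          continuous_on_restricted_tuple[OF g]]) auto
  fix c :: real and t :: "nat \<Rightarrow> real"
  assume "0 \<le> c"
  have "h (\<lambda>i. if i < n then g i (\<lambda>i. c * t i) else 0) = h (\<lambda>i. c * (if i < n then g i t else 0))"
    using hom_funs_scale[OF g \<open>0 \<le> c\<close>] by (intro hom_funs_cong[OF h]) auto
  then show "h (\<lambda>i. if i < n then g i (\<lambda>i. c * t i) else 0) = c * h (\<lambda>i. if i < n then g i t else 0)"
    using hom_funs_scale[OF h \<open>0 \<le> c\<close>] by simp
next
  fix s t :: "nat \<Rightarrow> real"
  assume "\<forall>i<m. s i = t i"
  then show "h (\<lambda>i. if i < n then g i s else 0) = h (\<lambda>i. if i < n then g i t else 0)"
    by (intro hom_funs_cong[OF h]) (auto intro: hom_funs_cong[OF g])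
qed

text \<open>By uniqueness: the right-hand side, as a function of \<open>h\<close>, is a calculus for \<open>x\<close>.\<close>

lemma krivine_compose:
  assumes h: "h \<in> hom_funs n" and g: "\<And>i. i < n \<Longrightarrow> g i \<in> hom_funs m"
    and x: "\<And>i. i < n \<Longrightarrow> krivine m z (g i) = x i"
  shows "krivine n x h = krivine m z (\<lambda>t. h (\<lambda>i. if i < n then g i t else 0))"
proof -
  define \<tau> where "\<tau> = restrict (\<lambda>h. krivine m z (\<lambda>t. h (\<lambda>i. if i < n then g i t else 0))) (hom_funs n)"
  have "is_krivine_calculus n x \<tau>"
    unfolding is_krivine_calculus_def
  proof (intro conjI ballI allI impI)
    show "\<tau> \<in> extensional (hom_funs n)"
      by (simp add: \<tau>_def)
    show "\<tau> (\<lambda>t. t j) = x j" if "j < n" for j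
      using that x by (simp add: \<tau>_def hom_funs_proj)
  qed (simp_all add: \<tau>_def hom_funs_add hom_funs_mult hom_funs_max
      krivine_add krivine_scale krivine_max hom_funs_compose g)
  from krivine_eqI[OF this] h show ?thesis
    by (simp add: \<tau>_def)
qed

lemma norm_mono_nonneg: "0 \<le> x \<Longrightarrow> x \<le> y \<Longrightarrow> norm x \<le> norm y" for x y :: "'a::banach_lattice"
  by (rule norm_mono_abs) (simp add: abs_of_nonneg order_trans[of 0 x y])

section \<open>The lattice norm of a finite tuple\<close>

context banach_sequence_lattice
begin

definition unit_norm :: "nat \<Rightarrow> real" where
  "unit_norm i = normY (\<lambda>k. if k = i then 1 else 0)"

definition tuple_norm :: "nat \<Rightarrow> (nat \<Rightarrow> real) \<Rightarrow> real" where
  "tuple_norm n t = normY (\<lambda>i. if i < n then t i else 0)"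

lemma krivine_norm_tuple_norm: "krivine_norm normY n x = krivine n x (tuple_norm n)"
  by (simp add: krivine_norm_def tuple_norm_def[abs_def])

lemma unit_norm_pos: "0 < unit_norm i"
proof -
  have "(\<lambda>k. if k = i then 1 else 0 :: real) \<noteq> 0"
    by (auto simp: fun_eq_iff)
  then have "unit_norm i \<noteq> 0"
    using norm_eq_zero[OF unit_mem] by (simp add: unit_norm_def)
  then show ?thesis
    using norm_nonneg[OF unit_mem, of i] by (simp add: unit_norm_def)
qed

section \<open>The norm of Y on finite tuples\<close>

lemma truncation_Suc:
  "(\<lambda>i. if i < Suc n then t i else 0) =
    (\<lambda>i. if i < n then t i else 0) + t n *\<^sub>R (\<lambda>k. if k = n then 1 else 0 :: real)"
  by (auto simp: fun_eq_iff less_Suc_eq)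

lemma truncation_mem: "(\<lambda>i. if i < n then t i else 0) \<in> Y"
proof (induction n)
  case 0
  show ?case
    using subspace_0[OF subspace] by (simp add: zero_fun_def)
next
  case (Suc n)
  then show ?case
    unfolding truncation_Suc by (intro subspace_add[OF subspace] subspace_scale[OF subspace] unit_mem)
qed

lemma tuple_norm_nonneg: "0 \<le> tuple_norm n t"
  unfolding tuple_norm_def by (rule norm_nonneg[OF truncation_mem])

lemma tuple_norm_mono: "(\<And>i. i < n \<Longrightarrow> \<bar>s i\<bar> \<le> \<bar>t i\<bar>) \<Longrightarrow> tuple_norm n s \<le> tuple_norm n t"
  unfolding tuple_norm_def by (rule ideal_norm[OF truncation_mem]) auto

lemma tuple_norm_mono_index: "m \<le> n \<Longrightarrow> tuple_norm m t \<le> tuple_norm n t"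
  unfolding tuple_norm_def by (rule ideal_norm[OF truncation_mem]) auto

lemma tuple_norm_cong: "(\<And>i. i < n \<Longrightarrow> s i = t i) \<Longrightarrow> tuple_norm n s = tuple_norm n t"
  by (intro antisym tuple_norm_mono) auto

lemma tuple_norm_scale: "tuple_norm n (\<lambda>i. r * t i) = \<bar>r\<bar> * tuple_norm n t"
proof -
  have "(\<lambda>i. if i < n then r * t i else 0) = r *\<^sub>R (\<lambda>i. if i < n then t i else 0)"
    by (auto simp: fun_eq_iff)
  then show ?thesis
    by (simp add: tuple_norm_def norm_scaleR[OF truncation_mem])
qed

lemma tuple_norm_triangle: "tuple_norm n (\<lambda>i. s i + t i) \<le> tuple_norm n s + tuple_norm n t"
proof -
  have "(\<lambda>i. if i < n then s i + t i else 0) =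
      (\<lambda>i. if i < n then s i else 0) + (\<lambda>i. if i < n then t i else 0)"
    by (auto simp: fun_eq_iff)
  then show ?thesis
    by (simp add: tuple_norm_def norm_triangle[OF truncation_mem truncation_mem])
qed

lemma tuple_norm_ge_entry: "i < n \<Longrightarrow> unit_norm i * \<bar>t i\<bar> \<le> tuple_norm n t"
proof -
  assume i: "i < n"
  have "normY (t i *\<^sub>R (\<lambda>k. if k = i then 1 else 0)) \<le> tuple_norm n t"
    unfolding tuple_norm_def using i by (intro ideal_norm[OF truncation_mem]) auto
  then show ?thesis
    by (simp add: norm_scaleR[OF unit_mem] unit_norm_def mult.commute)
qed

text \<open>Together with \<open>tuple_norm_ge_entry\<close> this compares the norm of an
  \<open>n\<close>-tuple with its entries. Transferred to X, the lower bound makes Cauchy sequences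
  converge entrywise, and the upper bound makes the norm continuous in the entries for fixed
  \<open>n\<close>.\<close>

lemma tuple_norm_le_sum: "tuple_norm n t \<le> (\<Sum>i<n. unit_norm i * \<bar>t i\<bar>)"
proof (induction n)
  case 0
  have "0 \<in> Y"
    by (rule subspace_0[OF subspace])
  then show ?case
    using norm_eq_zero[of 0] by (simp add: tuple_norm_def zero_fun_def)
next
  case (Suc n)
  have "tuple_norm (Suc n) t \<le> tuple_norm n t + normY (t n *\<^sub>R (\<lambda>k. if k = n then 1 else 0))"
    unfolding tuple_norm_def truncation_Suc
    by (intro norm_triangle truncation_mem subspace_scale[OF subspace] unit_mem)
  also have "normY (t n *\<^sub>R (\<lambda>k. if k = n then 1 else 0)) = unit_norm n * \<bar>t n\<bar>"
    by (simp add: norm_scaleR[OF unit_mem] unit_norm_def mult.commute)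
  finally show ?case
    using Suc by simp
qed

lemma tuple_norm_diff_le: "\<bar>tuple_norm n s - tuple_norm n t\<bar> \<le> (\<Sum>i<n. unit_norm i * \<bar>s i - t i\<bar>)"
proof -
  have *: "tuple_norm n s \<le> tuple_norm n t + tuple_norm n (\<lambda>i. s i - t i)" for s t
    using tuple_norm_triangle[of n t "\<lambda>i. s i - t i"] by simp
  have "tuple_norm n (\<lambda>i. t i - s i) = tuple_norm n (\<lambda>i. s i - t i)"
    by (intro antisym tuple_norm_mono) auto
  with *[of s t] *[of t s] have "\<bar>tuple_norm n s - tuple_norm n t\<bar> \<le> tuple_norm n (\<lambda>i. s i - t i)"
    by simp
  with tuple_norm_le_sum[of n "\<lambda>i. s i - t i"] show ?thesis
    by simp
qed

text \<open>The Lipschitz bound involves only the first \<open>n\<close> coordinates, which are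
  continuous for the product topology.\<close>

lemma tuple_norm_hom_funs: "tuple_norm n \<in> hom_funs n"
proof -
  have "continuous_on UNIV (tuple_norm n)"
    unfolding continuous_on_def
  proof
    fix t :: "nat \<Rightarrow> real"
    have "continuous_on UNIV (\<lambda>s. \<Sum>i<n. unit_norm i * \<bar>s i - t i\<bar>)"
      by (intro continuous_intros continuous_on_product_coordinates)
    then have "((\<lambda>s. \<Sum>i<n. unit_norm i * \<bar>s i - t i\<bar>) \<longlongrightarrow> (\<Sum>i<n. unit_norm i * \<bar>t i - t i\<bar>)) (at t)"
      unfolding continuous_on_def by blast
    then have "((\<lambda>s. \<Sum>i<n. unit_norm i * \<bar>s i - t i\<bar>) \<longlongrightarrow> 0) (at t)"
      by simp
    then have "((\<lambda>s. tuple_norm n s - tuple_norm n t) \<longlongrightarrow> 0) (at t)"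
      by (rule Lim_null_comparison[rotated]) (auto intro!: always_eventually tuple_norm_diff_le)
    then show "(tuple_norm n \<longlongrightarrow> tuple_norm n t) (at t)"
      by (rule LIM_zero_cancel)
  qed
  then show ?thesis
    by (auto simp: hom_funs_def tuple_norm_scale intro: tuple_norm_cong)
qed

lemma tuple_norm_compose_hom_funs:
  "(\<And>i. i < n \<Longrightarrow> g i \<in> hom_funs m) \<Longrightarrow> (\<lambda>t. tuple_norm n (\<lambda>i. g i t)) \<in> hom_funs m"
  using hom_funs_compose[OF tuple_norm_hom_funs, of n g m]
  by (simp add: tuple_norm_def cong: if_cong)

text \<open>The means of transfer: norms of different tuples become values of one calculus on a
  common tuple \<open>z\<close>, where \<open>krivine_mono\<close> can compare them.\<close>

lemma krivine_norm_compose: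
  assumes "\<And>i. i < n \<Longrightarrow> g i \<in> hom_funs m" "\<And>i. i < n \<Longrightarrow> krivine m z (g i) = x i"
  shows "krivine_norm normY n x = krivine m z (\<lambda>t. tuple_norm n (\<lambda>i. g i t))"
  using krivine_compose[OF tuple_norm_hom_funs assms]
  by (simp add: krivine_norm_tuple_norm) (simp add: tuple_norm_def cong: if_cong)

section \<open>Norm inequalities transferred to tuples in X\<close>

lemma krivine_norm_nonneg: "0 \<le> krivine_norm normY n x"
proof -
  have "krivine n x (\<lambda>t. 0) \<le> krivine n x (tuple_norm n)"
    by (intro krivine_mono tuple_norm_hom_funs piecewise_linear_hom_funs[OF piecewise_linear.zero]
        tuple_norm_nonneg)
  then show ?thesis
    by (simp add: krivine_norm_tuple_norm krivine_piecewise_linear[OF piecewise_linear.zero])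
qed

lemma krivine_norm_scale: "krivine_norm normY n (\<lambda>i. r *\<^sub>R x i) = \<bar>r\<bar> *\<^sub>R krivine_norm normY n x"
proof -
  have "krivine_norm normY n (\<lambda>i. r *\<^sub>R x i) = krivine n x (\<lambda>t. tuple_norm n (\<lambda>i. r * t i))"
    by (rule krivine_norm_compose) (simp_all add: hom_funs_mult hom_funs_proj krivine_scale krivine_proj)
  then show ?thesis
    by (simp add: tuple_norm_scale krivine_scale tuple_norm_hom_funs krivine_norm_tuple_norm)
qed

lemma krivine_norm_triangle:
  "krivine_norm normY n (\<lambda>i. x i + y i) \<le> krivine_norm normY n x + krivine_norm normY n y"
proof -
  \<comment> \<open>In the variables of \<open>z\<close>, entry \<open>i\<close> stands for
    \<open>x i\<close> and entry \<open>n + i\<close> for \<open>y i\<close>, so the claim becomes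
    the triangle inequality of Y at each real tuple.\<close>
  define z where "z i = (if i < n then x i else y (i - n))" for i
  have x: "krivine_norm normY n x = krivine (n + n) z (\<lambda>t. tuple_norm n (\<lambda>i. t i))"
    by (rule krivine_norm_compose) (simp_all add: hom_funs_proj krivine_proj z_def)
  have y: "krivine_norm normY n y = krivine (n + n) z (\<lambda>t. tuple_norm n (\<lambda>i. t (n + i)))"
    by (rule krivine_norm_compose) (simp_all add: hom_funs_proj krivine_proj z_def)
  have "krivine_norm normY n (\<lambda>i. x i + y i) =
      krivine (n + n) z (\<lambda>t. tuple_norm n (\<lambda>i. t i + t (n + i)))"
    by (rule krivine_norm_compose)
      (simp_all add: hom_funs_proj hom_funs_add krivine_add krivine_proj z_def)
  also have "\<dots> \<le> krivine (n + n) z (\<lambda>t. tuple_norm n (\<lambda>i. t i) + tuple_norm n (\<lambda>i. t (n + i)))"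
    by (intro krivine_mono hom_funs_add tuple_norm_compose_hom_funs hom_funs_proj tuple_norm_triangle) auto
  also have "\<dots> = krivine_norm normY n x + krivine_norm normY n y"
    unfolding x y by (intro krivine_add tuple_norm_compose_hom_funs hom_funs_proj) auto
  finally show ?thesis .
qed

lemma krivine_norm_abs: "krivine_norm normY n (\<lambda>i. \<bar>x i\<bar>) = krivine_norm normY n x"
proof -
  have pl: "piecewise_linear n x (\<lambda>t. \<bar>t i\<bar>) \<bar>x i\<bar>" if "i < n" for i
    using that by (intro piecewise_linear_abs piecewise_linear.proj)
  have "krivine_norm normY n (\<lambda>i. \<bar>x i\<bar>) = krivine n x (\<lambda>t. tuple_norm n (\<lambda>i. \<bar>t i\<bar>))"
    by (rule krivine_norm_compose) (use pl in \<open>auto intro: piecewise_linear_hom_funs krivine_piecewise_linear\<close>)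
  also have "(\<lambda>t. tuple_norm n (\<lambda>i. \<bar>t i\<bar>)) = tuple_norm n"
    by (intro ext antisym tuple_norm_mono) auto
  finally show ?thesis
    by (simp add: krivine_norm_tuple_norm)
qed

text \<open>The hypothesis holds for these particular elements of X, not for real variables, so it
  cannot be compared pointwise. Writing \<open>\<bar>y i\<bar>\<close> as the supremum of
  \<open>\<bar>x i\<bar>\<close> and \<open>\<bar>y i\<bar>\<close> makes it the value of a function
  that dominates the \<open>i\<close>-th coordinate everywhere.\<close>

lemma krivine_norm_mono:
  assumes le: "\<And>i. i < n \<Longrightarrow> \<bar>x i\<bar> \<le> \<bar>y i\<bar>"
  shows "krivine_norm normY n x \<le> krivine_norm normY n y"
proof -
  define z where "z i = (if i < n then x i else y (i - n))" for i
  have pl: "piecewise_linear (n + n) z (\<lambda>t. max \<bar>t i\<bar> \<bar>t (n + i)\<bar>) \<bar>y i\<bar>" if "i < n" for i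
  proof -
    have "piecewise_linear (n + n) z (\<lambda>t. max \<bar>t i\<bar> \<bar>t (n + i)\<bar>) (sup \<bar>z i\<bar> \<bar>z (n + i)\<bar>)"
      using that by (intro piecewise_linear.max piecewise_linear_abs piecewise_linear.proj) auto
    moreover have "sup \<bar>z i\<bar> \<bar>z (n + i)\<bar> = \<bar>y i\<bar>"
      using that le[OF that] by (simp add: z_def sup_absorb2)
    ultimately show ?thesis
      by simp
  qed
  have x: "krivine_norm normY n x = krivine (n + n) z (\<lambda>t. tuple_norm n (\<lambda>i. t i))"
    by (rule krivine_norm_compose) (simp_all add: hom_funs_proj krivine_proj z_def)
  also have "\<dots> \<le> krivine (n + n) z (\<lambda>t. tuple_norm n (\<lambda>i. max \<bar>t i\<bar> \<bar>t (n + i)\<bar>))"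
    by (intro krivine_mono tuple_norm_compose_hom_funs hom_funs_proj
        piecewise_linear_hom_funs[OF pl] tuple_norm_mono) auto
  also have "\<dots> = krivine_norm normY n (\<lambda>i. \<bar>y i\<bar>)"
    by (rule krivine_norm_compose[symmetric])
      (use pl in \<open>auto intro: piecewise_linear_hom_funs krivine_piecewise_linear\<close>)
  finally show ?thesis
    by (simp add: krivine_norm_abs)
qed

lemma krivine_norm_mono_index:
  assumes "m \<le> n"
  shows "krivine_norm normY m x \<le> krivine_norm normY n x"
proof -
  have "krivine_norm normY m x = krivine n x (\<lambda>t. tuple_norm m (\<lambda>i. t i))"
    using assms by (intro krivine_norm_compose) (simp_all add: hom_funs_proj krivine_proj)
  also have "\<dots> \<le> krivine n x (tuple_norm n)"
    using assms
    by (intro krivine_mono tuple_norm_compose_hom_funs tuple_norm_hom_funs hom_funs_proj tuple_norm_mono_index) auto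
  finally show ?thesis
    by (simp add: krivine_norm_tuple_norm)
qed

lemma krivine_norm_ge_entry:
  assumes "i < n"
  shows "unit_norm i *\<^sub>R \<bar>x i\<bar> \<le> krivine_norm normY n x"
proof -
  have pl: "piecewise_linear n x (\<lambda>t. unit_norm i * \<bar>t i\<bar>) (unit_norm i *\<^sub>R \<bar>x i\<bar>)"
    using assms by (intro piecewise_linear.scale piecewise_linear_abs piecewise_linear.proj)
  have "krivine n x (\<lambda>t. unit_norm i * \<bar>t i\<bar>) \<le> krivine n x (tuple_norm n)"
    using assms by (intro krivine_mono piecewise_linear_hom_funs[OF pl] tuple_norm_hom_funs tuple_norm_ge_entry)
  then show ?thesis
    by (simp add: krivine_piecewise_linear[OF pl] krivine_norm_tuple_norm)
qed

lemma krivine_norm_le_sum: "krivine_norm normY n x \<le> (\<Sum>i<n. unit_norm i *\<^sub>R \<bar>x i\<bar>)"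
proof -
  have pl: "piecewise_linear n x (\<lambda>t. \<Sum>i<n. unit_norm i * \<bar>t i\<bar>) (\<Sum>i<n. unit_norm i *\<^sub>R \<bar>x i\<bar>)"
    by (intro piecewise_linear_sum piecewise_linear.scale piecewise_linear_abs piecewise_linear.proj) auto
  have "krivine n x (tuple_norm n) \<le> krivine n x (\<lambda>t. \<Sum>i<n. unit_norm i * \<bar>t i\<bar>)"
    by (intro krivine_mono piecewise_linear_hom_funs[OF pl] tuple_norm_hom_funs tuple_norm_le_sum)
  then show ?thesis
    by (simp add: krivine_piecewise_linear[OF pl] krivine_norm_tuple_norm)
qed

lemma norm_krivine_norm_ge_entry:
  assumes "i < n"
  shows "unit_norm i * norm (x i) \<le> norm (krivine_norm normY n x)"
proof -
  have "norm (unit_norm i *\<^sub>R \<bar>x i\<bar>) \<le> norm (krivine_norm normY n x)"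
    using unit_norm_pos[of i] by (intro norm_mono_nonneg krivine_norm_ge_entry assms scaleR_nonneg_nonneg) auto
  then show ?thesis
    using unit_norm_pos[of i] by simp
qed

lemma norm_krivine_norm_le_sum:
  "norm (krivine_norm normY n x) \<le> (\<Sum>i<n. unit_norm i * norm (x i))"
proof -
  have "norm (krivine_norm normY n x) \<le> norm (\<Sum>i<n. unit_norm i *\<^sub>R \<bar>x i\<bar>)"
    by (intro norm_mono_nonneg krivine_norm_nonneg krivine_norm_le_sum)
  also have "\<dots> \<le> (\<Sum>i<n. norm (unit_norm i *\<^sub>R \<bar>x i\<bar>))"
    by (rule norm_sum)
  finally show ?thesis
    using unit_norm_pos by (simp add: less_imp_le)
qed

lemma norm_krivine_norm_triangle:
  "norm (krivine_norm normY n (\<lambda>i. x i + y i)) \<le>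
    norm (krivine_norm normY n x) + norm (krivine_norm normY n y)"
  by (rule order_trans[OF norm_mono_nonneg[OF krivine_norm_nonneg krivine_norm_triangle] norm_triangle_ineq])

text \<open>The norm of \<open>x\<close> exceeds that of \<open>f k\<close> by at most a weighted
  sum of the norms of the \<open>n\<close> differences of entries, which tends to 0. This passes
  bounds to entrywise limits in the completeness proof.\<close>

lemma norm_krivine_norm_le_limit:
  assumes "\<And>i. i < n \<Longrightarrow> (\<lambda>k. f k i) \<longlonglongrightarrow> x i"
    and "\<forall>\<^sub>F k in sequentially. norm (krivine_norm normY n (f k)) \<le> C"
  shows "norm (krivine_norm normY n x) \<le> C"
proof (rule tendsto_lowerbound)
  have "((\<lambda>k. C + (\<Sum>i<n. unit_norm i * norm (x i - f k i))) \<longlonglongrightarrow> C + (\<Sum>i<n. unit_norm i * norm (x i - x i)))"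
    using assms(1) by (intro tendsto_intros) auto
  then show "((\<lambda>k. C + (\<Sum>i<n. unit_norm i * norm (x i - f k i))) \<longlonglongrightarrow> C)"
    by simp
  show "\<forall>\<^sub>F k in sequentially. norm (krivine_norm normY n x) \<le> C + (\<Sum>i<n. unit_norm i * norm (x i - f k i))"
    using assms(2)
  proof eventually_elim
    case (elim k)
    then show ?case
      using norm_krivine_norm_triangle[of n "f k" "\<lambda>i. x i - f k i"]
        norm_krivine_norm_le_sum[of n "\<lambda>i. x i - f k i"] by simp
  qed
qed simp

end


section \<open>The spaces of sequences\<close>

context banach_sequence_lattice
begin

section \<open>Norm and lattice structure of the full sequence space\<close>

lemma ell_tau_I:
  assumes "\<And>n. norm (krivine_norm normY n x) \<le> C"
  shows "x \<in> ell_tau normY" "ell_tau_norm normY x \<le> C"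
proof -
  show "x \<in> ell_tau normY"
    unfolding ell_tau_def by (intro CollectI bdd_aboveI2[where M = C] assms)
  show "ell_tau_norm normY x \<le> C"
    unfolding ell_tau_norm_def by (rule cSUP_least) (use assms in auto)
qed

lemma norm_krivine_norm_le_ell_tau_norm:
  assumes "x \<in> ell_tau normY"
  shows "norm (krivine_norm normY n x) \<le> ell_tau_norm normY x"
proof -
  \<comment> \<open>The supremum runs over indices from 1 on; passing to \<open>Suc n\<close> covers
    \<open>n = 0\<close>.\<close>
  have "norm (krivine_norm normY n x) \<le> norm (krivine_norm normY (Suc n) x)"
    by (intro norm_mono_nonneg krivine_norm_nonneg krivine_norm_mono_index) simp
  also have "\<dots> \<le> ell_tau_norm normY x"
    unfolding ell_tau_norm_def using assms by (intro cSUP_upper) (auto simp: ell_tau_def)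
  finally show ?thesis .
qed

lemma norm_entry_le_ell_tau_norm:
  "x \<in> ell_tau normY \<Longrightarrow> unit_norm i * norm (x i) \<le> ell_tau_norm normY x"
  by (rule order_trans[OF norm_krivine_norm_ge_entry norm_krivine_norm_le_ell_tau_norm]) auto

lemma ell_tau_norm_nonneg: "x \<in> ell_tau normY \<Longrightarrow> 0 \<le> ell_tau_norm normY x"
  by (rule order_trans[OF norm_ge_zero norm_krivine_norm_le_ell_tau_norm[of x 0]])

lemma ell_tau_solid:
  assumes "y \<in> ell_tau normY" "\<And>i. \<bar>x i\<bar> \<le> \<bar>y i\<bar>"
  shows "x \<in> ell_tau normY" "ell_tau_norm normY x \<le> ell_tau_norm normY y"
proof -
  have "norm (krivine_norm normY n x) \<le> ell_tau_norm normY y" for n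
    by (rule order_trans[OF norm_mono_nonneg[OF krivine_norm_nonneg krivine_norm_mono]
          norm_krivine_norm_le_ell_tau_norm]) (use assms in auto)
  from ell_tau_I[OF this]
  show "x \<in> ell_tau normY" "ell_tau_norm normY x \<le> ell_tau_norm normY y"
    by auto
qed

lemma ell_tau_abs:
  assumes "x \<in> ell_tau normY"
  shows "(\<lambda>i. \<bar>x i\<bar>) \<in> ell_tau normY" "ell_tau_norm normY (\<lambda>i. \<bar>x i\<bar>) \<le> ell_tau_norm normY x"
  using ell_tau_solid[OF assms, of "\<lambda>i. \<bar>x i\<bar>"] by auto

lemma ell_tau_add:
  assumes "x \<in> ell_tau normY" "y \<in> ell_tau normY"
  shows "x + y \<in> ell_tau normY" "ell_tau_norm normY (x + y) \<le> ell_tau_norm normY x + ell_tau_norm normY y"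
proof -
  have "norm (krivine_norm normY n (x + y)) \<le> ell_tau_norm normY x + ell_tau_norm normY y" for n
    using norm_krivine_norm_triangle[of n x y] norm_krivine_norm_le_ell_tau_norm[OF assms(1), of n]
      norm_krivine_norm_le_ell_tau_norm[OF assms(2), of n]
    by (simp add: plus_fun_def)
  from ell_tau_I[OF this]
  show "x + y \<in> ell_tau normY" "ell_tau_norm normY (x + y) \<le> ell_tau_norm normY x + ell_tau_norm normY y"
    by auto
qed

text \<open>Only one inequality is transferred from tuples; the other is the same inequality for the
  scalar \<open>inverse r\<close> and the sequence \<open>r *\<^sub>R x\<close>.\<close>

lemma ell_tau_scaleR:
  fixes x :: "nat \<Rightarrow> 'b::banach_lattice"
  assumes "x \<in> ell_tau normY"
  shows "r *\<^sub>R x \<in> ell_tau normY" "ell_tau_norm normY (r *\<^sub>R x) = \<bar>r\<bar> * ell_tau_norm normY x"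
proof -
  have le: "r *\<^sub>R x \<in> ell_tau normY \<and> ell_tau_norm normY (r *\<^sub>R x) \<le> \<bar>r\<bar> * ell_tau_norm normY x"
    if "x \<in> ell_tau normY" for r and x :: "nat \<Rightarrow> 'b"
  proof -
    have "norm (krivine_norm normY n (r *\<^sub>R x)) \<le> \<bar>r\<bar> * ell_tau_norm normY x" for n
      using norm_krivine_norm_le_ell_tau_norm[OF that, of n]
      by (simp add: scaleR_fun_def krivine_norm_scale mult_left_mono)
    from ell_tau_I[OF this] show ?thesis
      by simp
  qed
  show rx: "r *\<^sub>R x \<in> ell_tau normY"
    using le[OF assms] by simp
  show "ell_tau_norm normY (r *\<^sub>R x) = \<bar>r\<bar> * ell_tau_norm normY x"
  proof (cases "r = 0")
    case True
    then show ?thesis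
      using le[OF assms, of 0] ell_tau_norm_nonneg[of "0 :: nat \<Rightarrow> 'b"] by simp
  next
    case False
    have "ell_tau_norm normY (inverse r *\<^sub>R (r *\<^sub>R x)) \<le> \<bar>inverse r\<bar> * ell_tau_norm normY (r *\<^sub>R x)"
      by (rule conjunct2[OF le[OF rx]])
    then have "\<bar>r\<bar> * ell_tau_norm normY x \<le> ell_tau_norm normY (r *\<^sub>R x)"
      using False by (simp add: field_simps)
    with le[OF assms, of r] show ?thesis
      by simp
  qed
qed

lemma subspace_ell_tau: "subspace (ell_tau normY :: (nat \<Rightarrow> 'b::banach_lattice) set)"
proof (rule subspaceI)
  have "norm (krivine_norm normY n (0 :: nat \<Rightarrow> 'b)) \<le> 0" for n
    by (rule order_trans[OF norm_krivine_norm_le_sum]) simp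
  from ell_tau_I[OF this] show "(0 :: nat \<Rightarrow> 'b) \<in> ell_tau normY"
    by simp
qed (simp_all add: ell_tau_add ell_tau_scaleR)

lemma ell_tau_uminus:
  assumes "x \<in> ell_tau normY"
  shows "- x \<in> ell_tau normY" "ell_tau_norm normY (- x) = ell_tau_norm normY x"
  using ell_tau_scaleR[OF assms, of "-1"] by simp_all

lemma ell_tau_diff: "x \<in> ell_tau normY \<Longrightarrow> y \<in> ell_tau normY \<Longrightarrow> x - y \<in> ell_tau normY"
  by (rule subspace_diff[OF subspace_ell_tau])

text \<open>Combines the entrywise Lipschitz bound with solidity. With \<open>x' = y' = 0\<close> it
  shows that suprema stay in the space; in general it lets suprema pass to the closure of the
  finitely supported sequences.\<close>

lemma ell_tau_norm_sup_diff_le: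
  assumes x: "x \<in> ell_tau normY" "x' \<in> ell_tau normY" and y: "y \<in> ell_tau normY" "y' \<in> ell_tau normY"
  shows "sup x y - sup x' y' \<in> ell_tau normY"
    "ell_tau_norm normY (sup x y - sup x' y') \<le> ell_tau_norm normY (x - x') + ell_tau_norm normY (y - y')"
proof -
  let ?u = "\<lambda>i. \<bar>(x - x') i\<bar>" and ?v = "\<lambda>i. \<bar>(y - y') i\<bar>"
  note d = ell_tau_abs[OF ell_tau_diff[OF x]] ell_tau_abs[OF ell_tau_diff[OF y]]
  have "\<bar>(sup x y - sup x' y') i\<bar> \<le> \<bar>(?u + ?v) i\<bar>" for i
    using order_trans[OF sup_diff_le abs_ge_self, of "x i" "y i" "x' i" "y' i"] by simp
  note solid = ell_tau_solid[OF ell_tau_add(1)[OF d(1,3)] this]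
  show "sup x y - sup x' y' \<in> ell_tau normY"
    by (rule solid)
  show "ell_tau_norm normY (sup x y - sup x' y') \<le> ell_tau_norm normY (x - x') + ell_tau_norm normY (y - y')"
    using solid(2) ell_tau_add(2)[OF d(1,3)] d(2,4) by linarith
qed

lemma ell_tau_sup:
  assumes "x \<in> ell_tau normY" "y \<in> ell_tau normY"
  shows "sup x y \<in> ell_tau normY"
proof -
  have 0: "0 \<in> ell_tau normY"
    by (rule subspace_0[OF subspace_ell_tau])
  have "sup x y - sup 0 0 \<in> ell_tau normY"
    by (rule ell_tau_norm_sup_diff_le(1)[OF assms(1) 0 assms(2) 0])
  then show ?thesis
    by simp
qed

lemma ell_tau_complete:
  fixes f :: "nat \<Rightarrow> nat \<Rightarrow> 'b::banach_lattice"
  assumes f: "range f \<subseteq> ell_tau normY"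
    and cauchy: "\<forall>e>0. \<exists>M. \<forall>m\<ge>M. \<forall>n\<ge>M. ell_tau_norm normY (f m - f n) < e"
  shows "\<exists>l\<in>ell_tau normY. (\<lambda>n. ell_tau_norm normY (f n - l)) \<longlonglongrightarrow> 0"
proof -
  have mem: "f k \<in> ell_tau normY" for k
    using f by auto
  have "\<exists>l. (\<lambda>k. f k i) \<longlonglongrightarrow> l" for i
  proof -
    have "Cauchy (\<lambda>k. f k i)"
    proof (rule CauchyI)
      fix e :: real assume "0 < e"
      then have "0 < unit_norm i * e"
        using unit_norm_pos by simp
      then obtain M where M: "\<And>m n. m \<ge> M \<Longrightarrow> n \<ge> M \<Longrightarrow> ell_tau_norm normY (f m - f n) < unit_norm i * e"
        using cauchy by meson
      have "norm (f m i - f n i) < e" if "m \<ge> M" "n \<ge> M" for m n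
      proof -
        have "unit_norm i * norm (f m i - f n i) < unit_norm i * e"
          using norm_entry_le_ell_tau_norm[OF ell_tau_diff[OF mem mem], of i m n] M[OF that] by simp
        then show ?thesis
          using unit_norm_pos[of i] by simp
      qed
      then show "\<exists>M. \<forall>m\<ge>M. \<forall>n\<ge>M. norm (f m i - f n i) < e"
        by blast
    qed
    then show ?thesis
      by (simp add: Cauchy_convergent_iff convergent_def)
  qed
  then obtain l where l: "\<And>i. (\<lambda>k. f k i) \<longlonglongrightarrow> l i"
    by metis
  have le: "\<exists>M. \<forall>k\<ge>M. f k - l \<in> ell_tau normY \<and> ell_tau_norm normY (f k - l) \<le> e" if e: "0 < e" for e
  proof -
    obtain M where M: "\<And>m n. m \<ge> M \<Longrightarrow> n \<ge> M \<Longrightarrow> ell_tau_norm normY (f m - f n) < e"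
      using cauchy e by meson
    \<comment> \<open>Here \<open>k\<close> and \<open>n\<close> are fixed while the second index
      \<open>m\<close> of the Cauchy condition tends to infinity. Since \<open>M\<close> does not
      depend on \<open>n\<close>, the bound survives the supremum over \<open>n\<close>.\<close>
    have "norm (krivine_norm normY n (f k - l)) \<le> e" if k: "k \<ge> M" for k n
    proof (rule norm_krivine_norm_le_limit)
      show "(\<lambda>m. (f k - f m) i) \<longlonglongrightarrow> (f k - l) i" for i
        by (auto intro!: tendsto_intros l)
      have "norm (krivine_norm normY n (f k - f m)) \<le> e" if "m \<ge> M" for m
        using norm_krivine_norm_le_ell_tau_norm[OF ell_tau_diff[OF mem mem], of n k m] M[OF k that] by simp
      then show "\<forall>\<^sub>F m in sequentially. norm (krivine_norm normY n (f k - f m)) \<le> e"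
        by (auto simp: eventually_sequentially)
    qed
    from ell_tau_I[OF this] show ?thesis
      by blast
  qed
  \<comment> \<open>One such \<open>k\<close> puts \<open>l\<close> into the space, as the
    difference of \<open>f k\<close> and \<open>f k - l\<close>.\<close>
  obtain k where "f k - l \<in> ell_tau normY"
    using le[of 1] by auto
  from ell_tau_diff[OF mem[of k] this] have "l \<in> ell_tau normY"
    by simp
  moreover have "(\<lambda>n. ell_tau_norm normY (f n - l)) \<longlonglongrightarrow> 0"
  proof (rule LIMSEQ_I)
    fix e :: real assume "0 < e"
    then obtain M where "\<And>k. k \<ge> M \<Longrightarrow> f k - l \<in> ell_tau normY \<and> ell_tau_norm normY (f k - l) \<le> e / 2"
      using le[of "e / 2"] by auto
    then have "norm (ell_tau_norm normY (f k - l) - 0) < e" if "k \<ge> M" for k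
      using ell_tau_norm_nonneg[of "f k - l"] that \<open>0 < e\<close> by force
    then show "\<exists>M. \<forall>k\<ge>M. norm (ell_tau_norm normY (f k - l) - 0) < e"
      by blast
  qed
  ultimately show ?thesis
    by (intro bexI[of _ l])
qed

text \<open>Serves both spaces: for \<open>ell_tau normY\<close> itself closedness is immediate, and
  for \<open>ell_tau_0 normY\<close> it is the idempotence of closure. Suprema in \<open>V\<close>
  are entrywise, which is why closure under \<open>sup\<close> is asked for.\<close>

lemma banach_lattice_on_closed_sublattice:
  fixes V :: "(nat \<Rightarrow> 'b::banach_lattice) set"
  assumes V: "subspace V" "V \<subseteq> ell_tau normY"
    and sup: "\<And>x y. x \<in> V \<Longrightarrow> y \<in> V \<Longrightarrow> sup x y \<in> V"
    and closed: "\<And>x. x \<in> ell_tau normY \<Longrightarrow> \<forall>e>0. \<exists>y\<in>V. ell_tau_norm normY (x - y) < e \<Longrightarrow> x \<in> V"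
  shows "banach_lattice_on V (ell_tau_norm normY)"
proof -
  have nonneg: "0 \<le> ell_tau_norm normY x" if "x \<in> V" for x
    using V that ell_tau_norm_nonneg by blast
  have eq_zero: "ell_tau_norm normY x = 0 \<longleftrightarrow> x = 0" if "x \<in> V" for x
  proof
    have x: "x \<in> ell_tau normY"
      using V that by blast
    assume "ell_tau_norm normY x = 0"
    then have "\<forall>i. unit_norm i * norm (x i) \<le> 0"
      using norm_entry_le_ell_tau_norm[OF x] by simp
    then have "x i = 0" for i
      using unit_norm_pos[of i] by (auto simp: mult_le_0_iff dest: spec[of _ i])
    then show "x = 0"
      by (simp add: fun_eq_iff)
  next
    show "x = 0 \<Longrightarrow> ell_tau_norm normY x = 0"
      using ell_tau_scaleR(2)[OF subspace_0[OF subspace_ell_tau], of 0] by simp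
  qed
  have scale: "ell_tau_norm normY (r *\<^sub>R x) = \<bar>r\<bar> * ell_tau_norm normY x" if "x \<in> V" for x r
    using V that ell_tau_scaleR by blast
  have triangle: "ell_tau_norm normY (x + y) \<le> ell_tau_norm normY x + ell_tau_norm normY y" if "x \<in> V" "y \<in> V" for x y
    using V that ell_tau_add by blast
  have complete: "\<exists>l\<in>V. (\<lambda>n. ell_tau_norm normY (f n - l)) \<longlonglongrightarrow> 0"
    if f: "range f \<subseteq> V" "\<forall>e>0. \<exists>M. \<forall>m\<ge>M. \<forall>n\<ge>M. ell_tau_norm normY (f m - f n) < e" for f
  proof -
    obtain l where l: "l \<in> ell_tau normY" "(\<lambda>n. ell_tau_norm normY (f n - l)) \<longlonglongrightarrow> 0"
      using ell_tau_complete[OF _ f(2)] f(1) V(2) by blast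
    have "\<exists>y\<in>V. ell_tau_norm normY (l - y) < e" if "0 < e" for e
    proof -
      have "\<forall>\<^sub>F n in sequentially. ell_tau_norm normY (f n - l) < e"
        using order_tendstoD(2)[OF l(2) that] .
      then obtain n where "ell_tau_norm normY (f n - l) < e"
        using eventually_happens'[OF sequentially_bot] by blast
      moreover have "f n \<in> V"
        using f(1) by auto
      moreover have "ell_tau_norm normY (l - f n) = ell_tau_norm normY (f n - l)"
        using ell_tau_uminus(2)[of "f n - l"] ell_tau_diff[OF _ l(1), of "f n"] \<open>f n \<in> V\<close> V(2) by auto
      ultimately show ?thesis
        by (intro bexI[of _ "f n"]) simp_all
    qed
    then have "l \<in> V"
      using closed[OF l(1)] by blast
    with l(2) show ?thesis
      by (intro bexI[of _ l])
  qed
  have sup_in: "is_sup_in V x y (sup x y)" if "x \<in> V" "y \<in> V" for x y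
    unfolding is_sup_in_def by (intro conjI ballI impI sup that sup_ge1 sup_ge2 sup_least)
  have inf_in: "is_inf_in V x y (inf x y)" if "x \<in> V" "y \<in> V" for x y
  proof -
    have "inf x y = - sup (- x) (- y)"
      by (rule ext) (simp only: inf_apply sup_apply uminus_apply inf_eq_neg_sup)
    also have "\<dots> \<in> V"
      by (intro subspace_neg[OF V(1)] sup that)
    finally show ?thesis
      unfolding is_inf_in_def by (intro conjI ballI impI inf_le1 inf_le2 inf_greatest)
  qed
  have mono: "ell_tau_norm normY x \<le> ell_tau_norm normY y"
    if "x \<in> V" "y \<in> V" "is_sup_in V x (- x) a" "is_sup_in V y (- y) b" "a \<le> b" for x y a b
  proof -
    have abs: "\<bar>x i\<bar> = a i" if x: "x \<in> V" and a: "is_sup_in V x (- x) a" for x a i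
    proof -
      \<comment> \<open>The entrywise modulus lies in \<open>V\<close>, so by uniqueness of suprema
        the modulus taken within \<open>V\<close> is the entrywise one, and solidity
        applies.\<close>
      have "sup x (- x) \<in> V"
        by (intro sup x subspace_neg[OF V(1)])
      then have "a = sup x (- x)"
        using a by (auto simp: is_sup_in_def intro!: antisym)
      then show ?thesis
        by (simp add: abs_lattice)
    qed
    have "\<bar>x i\<bar> \<le> \<bar>y i\<bar>" for i
      using abs[OF that(1,3)] abs[OF that(2,4)] that(5) by (simp add: le_fun_def)
    then show ?thesis
      using V(2) that(2) by (intro ell_tau_solid(2)) auto
  qed
  show ?thesis
  proof (intro banach_lattice_on.intro banach_space_on.intro banach_lattice_on_axioms.intro)
    fix x y
    assume "x \<in> V" "y \<in> V"
    from sup_in[OF this] show "\<exists>s. is_sup_in V x y s"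
      by (rule exI[of _ "sup x y"])
  next
    fix x y
    assume "x \<in> V" "y \<in> V"
    from inf_in[OF this] show "\<exists>s. is_inf_in V x y s"
      by (rule exI[of _ "inf x y"])
  qed (fact V nonneg eq_zero scale triangle complete mono)+
qed

section \<open>Finitely supported sequences and their closure\<close>

lemma subspace_ell_tau_00: "subspace (ell_tau_00 normY :: (nat \<Rightarrow> 'b::banach_lattice) set)"
proof (rule subspaceI)
  show "(0 :: nat \<Rightarrow> 'b) \<in> ell_tau_00 normY"
    by (simp add: ell_tau_00_def subspace_0[OF subspace_ell_tau])
  show "x + y \<in> ell_tau_00 normY" if "x \<in> ell_tau_00 normY" "y \<in> ell_tau_00 normY" for x y :: "nat \<Rightarrow> 'b"
  proof -
    from that obtain m n where "\<forall>k\<ge>m. x k = 0" "\<forall>k\<ge>n. y k = 0"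
      by (auto simp: ell_tau_00_def)
    then have "\<forall>k\<ge>max m n. (x + y) k = 0"
      by simp
    then have "\<exists>m. \<forall>k\<ge>m. (x + y) k = 0" ..
    with that show ?thesis
      by (simp add: ell_tau_00_def ell_tau_add)
  qed
  show "r *\<^sub>R x \<in> ell_tau_00 normY" if "x \<in> ell_tau_00 normY" for r and x :: "nat \<Rightarrow> 'b"
    using that by (auto simp: ell_tau_00_def ell_tau_scaleR)
qed

lemma ell_tau_00_sup:
  assumes "x \<in> ell_tau_00 normY" "y \<in> ell_tau_00 normY"
  shows "sup x y \<in> ell_tau_00 normY"
proof -
  obtain m n where "\<forall>k\<ge>m. x k = 0" "\<forall>k\<ge>n. y k = 0"
    using assms by (auto simp: ell_tau_00_def)
  then have "\<forall>k\<ge>max m n. (sup x y) k = 0"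
    by simp
  then have "\<exists>m. \<forall>k\<ge>m. (sup x y) k = 0" ..
  with assms show ?thesis
    by (simp add: ell_tau_00_def ell_tau_sup)
qed

lemma ell_tau_0_approx:
  assumes "x \<in> ell_tau_0 normY" "0 < e"
  obtains y where "y \<in> ell_tau_00 normY" "y \<in> ell_tau normY" "ell_tau_norm normY (x - y) < e"
proof -
  obtain y where "y \<in> ell_tau_00 normY" "ell_tau_norm normY (x - y) < e"
    using assms unfolding ell_tau_0_def by blast
  moreover from this have "y \<in> ell_tau normY"
    by (simp add: ell_tau_00_def)
  ultimately show ?thesis
    using that by blast
qed

lemma subspace_ell_tau_0: "subspace (ell_tau_0 normY :: (nat \<Rightarrow> 'b::banach_lattice) set)"
proof (rule subspaceI)
  have "ell_tau_norm normY (0 :: nat \<Rightarrow> 'b) = 0"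
    using ell_tau_scaleR(2)[OF subspace_0[OF subspace_ell_tau], of 0] by simp
  then show "(0 :: nat \<Rightarrow> 'b) \<in> ell_tau_0 normY"
    using subspace_0[OF subspace_ell_tau] subspace_0[OF subspace_ell_tau_00]
    by (auto simp: ell_tau_0_def intro!: bexI[of _ 0])
next
  fix x y :: "nat \<Rightarrow> 'b"
  assume xy: "x \<in> ell_tau_0 normY" "y \<in> ell_tau_0 normY"
  then have mem: "x \<in> ell_tau normY" "y \<in> ell_tau normY"
    by (auto simp: ell_tau_0_def)
  have "\<exists>z\<in>ell_tau_00 normY. ell_tau_norm normY (x + y - z) < e" if "0 < e" for e
  proof -
    from that have e: "0 < e / 2"
      by simp
    obtain x' where x': "x' \<in> ell_tau_00 normY" "x' \<in> ell_tau normY" "ell_tau_norm normY (x - x') < e / 2"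
      by (rule ell_tau_0_approx[OF xy(1) e])
    obtain y' where y': "y' \<in> ell_tau_00 normY" "y' \<in> ell_tau normY" "ell_tau_norm normY (y - y') < e / 2"
      by (rule ell_tau_0_approx[OF xy(2) e])
    have "ell_tau_norm normY ((x - x') + (y - y')) < e"
      using ell_tau_add(2)[OF ell_tau_diff[OF mem(1) x'(2)] ell_tau_diff[OF mem(2) y'(2)]] x'(3) y'(3)
      by linarith
    then show ?thesis
      using subspace_add[OF subspace_ell_tau_00 x'(1) y'(1)]
      by (intro bexI[of _ "x' + y'"]) (simp_all add: add_diff_add)
  qed
  with mem show "x + y \<in> ell_tau_0 normY"
    by (simp add: ell_tau_0_def ell_tau_add)
next
  fix r and x :: "nat \<Rightarrow> 'b"
  assume x: "x \<in> ell_tau_0 normY"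
  then have mem: "x \<in> ell_tau normY"
    by (auto simp: ell_tau_0_def)
  have "\<exists>z\<in>ell_tau_00 normY. ell_tau_norm normY (r *\<^sub>R x - z) < e" if "0 < e" for e
  proof -
    \<comment> \<open>The added 1 covers \<open>r = 0\<close> and makes the final inequality
      strict.\<close>
    have e: "0 < e / (\<bar>r\<bar> + 1)"
      using that by (simp add: add_nonneg_pos)
    obtain x' where x': "x' \<in> ell_tau_00 normY" "x' \<in> ell_tau normY" "ell_tau_norm normY (x - x') < e / (\<bar>r\<bar> + 1)"
      by (rule ell_tau_0_approx[OF x e])
    have "\<bar>r\<bar> * ell_tau_norm normY (x - x') \<le> \<bar>r\<bar> * (e / (\<bar>r\<bar> + 1))"
      using x'(3) by (intro mult_left_mono) auto
    also have "\<dots> < e"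
      using that by (simp add: field_simps add_nonneg_pos)
    finally have "ell_tau_norm normY (r *\<^sub>R (x - x')) < e"
      by (simp add: ell_tau_scaleR ell_tau_diff mem x'(2))
    then show ?thesis
      using subspace_scale[OF subspace_ell_tau_00 x'(1), of r]
      by (intro bexI[of _ "r *\<^sub>R x'"]) (simp_all add: scaleR_diff_right)
  qed
  with mem show "r *\<^sub>R x \<in> ell_tau_0 normY"
    by (simp add: ell_tau_0_def ell_tau_scaleR)
qed

text \<open>By the Lipschitz bound, the supremum of two finitely supported approximants approximates
  the supremum.\<close>

lemma ell_tau_0_sup:
  assumes xy: "x \<in> ell_tau_0 normY" "y \<in> ell_tau_0 normY"
  shows "sup x y \<in> ell_tau_0 normY"
proof -
  have mem: "x \<in> ell_tau normY" "y \<in> ell_tau normY"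
    using xy by (auto simp: ell_tau_0_def)
  have "\<exists>z\<in>ell_tau_00 normY. ell_tau_norm normY (sup x y - z) < e" if "0 < e" for e
  proof -
    from that have e: "0 < e / 2"
      by simp
    obtain x' where x': "x' \<in> ell_tau_00 normY" "x' \<in> ell_tau normY" "ell_tau_norm normY (x - x') < e / 2"
      by (rule ell_tau_0_approx[OF xy(1) e])
    obtain y' where y': "y' \<in> ell_tau_00 normY" "y' \<in> ell_tau normY" "ell_tau_norm normY (y - y') < e / 2"
      by (rule ell_tau_0_approx[OF xy(2) e])
    have "ell_tau_norm normY (sup x y - sup x' y') < e"
      using ell_tau_norm_sup_diff_le(2)[OF mem(1) x'(2) mem(2) y'(2)] x'(3) y'(3) by linarith
    then show ?thesis
      using ell_tau_00_sup[OF x'(1) y'(1)] by blast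
  qed
  with mem show ?thesis
    by (simp add: ell_tau_0_def ell_tau_sup)
qed

lemma ell_tau_0_closed:
  assumes x: "x \<in> ell_tau normY" and approx: "\<forall>e>0. \<exists>y\<in>ell_tau_0 normY. ell_tau_norm normY (x - y) < e"
  shows "x \<in> ell_tau_0 normY"
proof -
  have "\<exists>z\<in>ell_tau_00 normY. ell_tau_norm normY (x - z) < e" if "0 < e" for e
  proof -
    from that have e: "0 < e / 2"
      by simp
    then obtain y where y: "y \<in> ell_tau_0 normY" "ell_tau_norm normY (x - y) < e / 2"
      using approx by blast
    obtain z where z: "z \<in> ell_tau_00 normY" "z \<in> ell_tau normY" "ell_tau_norm normY (y - z) < e / 2"
      by (rule ell_tau_0_approx[OF y(1) e])
    have "y \<in> ell_tau normY"
      using y(1) by (simp add: ell_tau_0_def)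
    from ell_tau_add(2)[OF ell_tau_diff[OF x this] ell_tau_diff[OF this z(2)]]
    have "ell_tau_norm normY (x - z) < e"
      using y(2) z(3) by simp
    with z(1) show ?thesis
      by blast
  qed
  with x show ?thesis
    by (simp add: ell_tau_0_def)
qed

end

theorem theorem20:
  fixes Y :: "(nat \<Rightarrow> real) set" and normY :: "(nat \<Rightarrow> real) \<Rightarrow> real"
  assumes "banach_sequence_lattice Y normY"
  shows "banach_lattice_on (ell_tau normY :: (nat \<Rightarrow> 'a::banach_lattice) set) (ell_tau_norm normY)
       \<and> banach_lattice_on (ell_tau_0 normY :: (nat \<Rightarrow> 'a) set) (ell_tau_norm normY)"
proof -
  interpret banach_sequence_lattice Y normY
    by fact
  show ?thesis
  proof
    show "banach_lattice_on (ell_tau normY :: (nat \<Rightarrow> 'a) set) (ell_tau_norm normY)"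
      by (rule banach_lattice_on_closed_sublattice) (auto intro: subspace_ell_tau ell_tau_sup)
    show "banach_lattice_on (ell_tau_0 normY :: (nat \<Rightarrow> 'a) set) (ell_tau_norm normY)"
    proof (rule banach_lattice_on_closed_sublattice)
      show "ell_tau_0 normY \<subseteq> (ell_tau normY :: (nat \<Rightarrow> 'a) set)"
        by (auto simp: ell_tau_0_def)
    qed (auto intro: subspace_ell_tau_0 ell_tau_0_sup ell_tau_0_closed)
  qed
qed

end
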